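(* Let $\Gamma$ be a triangulation of a connected closed $2$-dimensional surface $M$ with a $z$-orientation $\tau$ such that every face of $\Gamma$ is of type I, and let $\Gamma_{II}$ be the subgraph of $\Gamma$ formed by all vertices and edges of type II, regarded as a subset of $M$. Then: (1) every connected component of $M\setminus\Gamma_{II}$ is homeomorphic to an open $2$-dimensional disk, an open Möbius strip, or an open cylinder; (2) a connected component of $M\setminus\Gamma_{II}$ contains a vertex of type I if and only if it is homeomorphic to an open $2$-dimensional disk, and in that case it contains exactly one vertex of type I.
   Context: A triangulation $\Gamma$ of $M$ is a $2$-cell embedding of a connected simple finite graph in $M$ all of whose faces are triangles; every edge lies in exactly two distinct faces and two distinct faces meet in an edge, a vertex, or not at all. A zigzag in $\Gamma$ is a sequence of edges $(e_i)_{i\in\mathbb N}$ such that for every $i$: $e_i$ and $e_{i+1}$ are distinct edges of some face; the faces containing $e_i,e_{i+1}$ and $e_{i+1},e_{i+2}$ are distinct; and $e_i$, $e_{i+2}$ have no common vertex. A zigzag is periodic and is regarded as a cyclic sequence $e_1,\dots,e_n$ with $n$ minimal; the reversed sequence $Z^{-1}$ is also a zigzag and $Z\neq Z^{-1}$. A zigzag traverses each of its edges $e_i$ in a direction: from the common vertex of $e_{i-1},e_i$ to the common vertex of $e_i,e_{i+1}$. If $\Gamma$ has exactly $k$ zigzags up to reversal, a $z$-orientation $\tau$ is a set of $k$ zigzags containing exactly one of $Z,Z^{-1}$ for each zigzag $Z$. Each edge $e$ then occurs exactly twice in total among the zigzags of $\tau$; $e$ is of type I if these two occurrences traverse $e$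 in opposite directions and of type II if in the same direction. A vertex is of type I if all edges containing it are of type I, otherwise of type II. A face is of type I if it contains exactly two edges of type I and one edge of type II. *)

theory Defs
  imports "HOL-Analysis.Analysis"
begin

section \<open>Model surfaces\<close>

definition open_disk :: "complex topology" where
  "open_disk = top_of_set (ball 0 1)"

definition open_cylinder :: "(complex \<times> real) topology" where
  "open_cylinder = prod_topology (top_of_set (sphere 0 1)) (top_of_set {0<..<1})"

definition strip :: "(real \<times> real) set" where
  "strip = {0..1} \<times> {0<..<1}"

definition moebius_rel :: "((real \<times> real) \<times> (real \<times> real)) set" where
  "moebius_rel = {(p, q). p \<in> strip \<and> q \<in> strip \<and>
     (p = q \<or> {fst p, fst q} = {0, 1} \<and> snd q = 1 - snd p)}"

text \<open>The set of equivalence classes carries the quotient topology of the strip.\<close>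

definition open_moebius_strip :: "(real \<times> real) set topology" where
  "open_moebius_strip =
     topology (\<lambda>\<U>. \<U> \<subseteq> strip // moebius_rel \<and> openin (top_of_set strip) (\<Union>\<U>))"

lemma equiv_moebius_rel: "equiv strip moebius_rel"
proof (rule equivI)
  show "moebius_rel \<subseteq> strip \<times> strip"
    by (auto simp: moebius_rel_def)
  show "refl_on strip moebius_rel"
    by (auto simp: refl_on_def moebius_rel_def)
  show "sym moebius_rel"
    by (auto simp: sym_def moebius_rel_def insert_commute)
  show "trans moebius_rel"
    unfolding trans_def moebius_rel_def
    by (auto simp: doubleton_eq_iff prod_eq_iff)
qed

lemma openin_open_moebius_strip:
  "openin open_moebius_strip \<U> \<longleftrightarrow>
     \<U> \<subseteq> strip // moebius_rel \<and> openin (top_of_set strip) (\<Union>\<U>)"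
proof -
  have "istopology (\<lambda>\<U>. \<U> \<subseteq> strip // moebius_rel \<and> openin (top_of_set strip) (\<Union>\<U>))"
    unfolding istopology_def
  proof (intro conjI allI impI)
    fix \<U> \<V>
    assume U: "\<U> \<subseteq> strip // moebius_rel \<and> openin (top_of_set strip) (\<Union>\<U>)"
      and V: "\<V> \<subseteq> strip // moebius_rel \<and> openin (top_of_set strip) (\<Union>\<V>)"
    show "\<U> \<inter> \<V> \<subseteq> strip // moebius_rel"
      using U by blast
    have "A = B" if "A \<in> \<U>" "B \<in> \<V>" "x \<in> A" "x \<in> B" for A B x
      using quotient_disj[OF equiv_moebius_rel, of A B] that U V by blast
    then have "\<Union>(\<U> \<inter> \<V>) = \<Union>\<U> \<inter> \<Union>\<V>"
      by blast
    then show "openin (top_of_set strip) (\<Union>(\<U> \<inter> \<V>))"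
      using U V by (simp add: openin_Int)
  next
    fix \<K>
    assume K: "\<forall>\<U>\<in>\<K>. \<U> \<subseteq> strip // moebius_rel \<and> openin (top_of_set strip) (\<Union>\<U>)"
    then show "\<Union>\<K> \<subseteq> strip // moebius_rel"
      by blast
    have "\<Union>(\<Union>\<K>) = \<Union>(Union ` \<K>)"
      by blast
    then show "openin (top_of_set strip) (\<Union>(\<Union>\<K>))"
      using K by (metis (no_types, lifting) imageE openin_Union)
  qed
  then show ?thesis
    unfolding open_moebius_strip_def by (simp add: topology_inverse')
qed

lemma topspace_open_moebius_strip: "topspace open_moebius_strip = strip // moebius_rel"
proof -
  have "openin open_moebius_strip (strip // moebius_rel)"
    by (simp add: openin_open_moebius_strip Union_quotient[OF equiv_moebius_rel])
  then show ?thesis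
    unfolding topspace_def using openin_open_moebius_strip by blast
qed

section \<open>Triangulations of closed surfaces\<close>

definition closed_surface :: "'a topology \<Rightarrow> bool" where
  "closed_surface M \<longleftrightarrow>
     compact_space M \<and> Hausdorff_space M \<and> second_countable M \<and>
     (\<forall>x\<in>topspace M. \<exists>U. openin M U \<and> x \<in> U \<and> subtopology M U homeomorphic_space open_disk)"

text \<open>
  A graph in \<open>M\<close> is given by its set \<open>V\<close> of vertices, which are points of \<open>M\<close>, and its set \<open>E\<close>
  of edges, which are closed arcs in \<open>M\<close>. The ends of an edge \<open>e\<close> are the two elements of
  \<open>e \<inter> V\<close>.
\<close>

definition edge_arc :: "'a topology \<Rightarrow> 'a set \<Rightarrow> 'a set \<Rightarrow> bool" where
  "edge_arc M V e \<longleftrightarrow>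
     (\<exists>g. embedding_map (top_of_set {0..1::real}) M g \<and> g ` {0..1} = e \<and> e \<inter> V = {g 0, g 1})"

definition embedded_graph :: "'a topology \<Rightarrow> 'a set \<Rightarrow> 'a set set \<Rightarrow> bool" where
  "embedded_graph M V E \<longleftrightarrow>
     finite V \<and> finite E \<and> V \<noteq> {} \<and> V \<subseteq> topspace M \<and>
     (\<forall>e\<in>E. edge_arc M V e) \<and>
     (\<forall>e\<in>E. \<forall>e'\<in>E. e \<noteq> e' \<longrightarrow> e \<inter> e' \<subseteq> V)"

text \<open>Loops are already excluded, because the ends of an embedded arc are distinct.\<close>

definition simple_graph :: "'a set \<Rightarrow> 'a set set \<Rightarrow> bool" where
  "simple_graph V E \<longleftrightarrow> (\<forall>e\<in>E. \<forall>e'\<in>E. e \<inter> V = e' \<inter> V \<longrightarrow> e = e')"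

definition connected_graph :: "'a set \<Rightarrow> 'a set set \<Rightarrow> bool" where
  "connected_graph V E \<longleftrightarrow>
     (\<forall>u\<in>V. \<forall>v\<in>V. (u, v) \<in> {(x, y). \<exists>e\<in>E. e \<inter> V = {x, y}}\<^sup>*)"

definition open_faces :: "'a topology \<Rightarrow> 'a set \<Rightarrow> 'a set set \<Rightarrow> 'a set set" where
  "open_faces M V E = connected_components_of (subtopology M (topspace M - (V \<union> \<Union>E)))"

definition faces :: "'a topology \<Rightarrow> 'a set \<Rightarrow> 'a set set \<Rightarrow> 'a set set" where
  "faces M V E = (\<lambda>C. M closure_of C) ` open_faces M V E"

definition two_cell_embedding :: "'a topology \<Rightarrow> 'a set \<Rightarrow> 'a set set \<Rightarrow> bool" where
  "two_cell_embedding M V E \<longleftrightarrow>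
     embedded_graph M V E \<and>
     (\<forall>C\<in>open_faces M V E. subtopology M C homeomorphic_space open_disk)"

definition std_triangle :: "complex set" where
  "std_triangle = convex hull {0, 1, \<i>}"

text \<open>
  The closure of \<open>C\<close> is a closed triangle whose corners are vertices and whose sides are edges of
  the graph.
\<close>

definition triangular :: "'a topology \<Rightarrow> 'a set \<Rightarrow> 'a set set \<Rightarrow> 'a set \<Rightarrow> bool" where
  "triangular M V E C \<longleftrightarrow>
     (\<exists>h. embedding_map (top_of_set std_triangle) M h \<and>
          h ` std_triangle = M closure_of C \<and>
          h ` interior std_triangle = C \<and>
          h ` {0, 1, \<i>} \<subseteq> V \<and>
          h ` closed_segment 0 1 \<in> E \<and>
          h ` closed_segment 1 \<i> \<in> E \<and>
          h ` closed_segment \<i> 0 \<in> E)"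

definition surface_triangulation :: "'a topology \<Rightarrow> 'a set \<Rightarrow> 'a set set \<Rightarrow> bool" where
  "surface_triangulation M V E \<longleftrightarrow>
     two_cell_embedding M V E \<and> simple_graph V E \<and> connected_graph V E \<and>
     (\<forall>C\<in>open_faces M V E. triangular M V E C) \<and>
     (\<forall>e\<in>E. card {F \<in> faces M V E. e \<subseteq> F} = 2) \<and>
     (\<forall>F\<in>faces M V E. \<forall>F'\<in>faces M V E. F \<noteq> F' \<longrightarrow>
        F \<inter> F' \<in> E \<or> (\<exists>v\<in>V. F \<inter> F' = {v}) \<or> F \<inter> F' = {})"

section \<open>Zigzags and z-orientations\<close>

definition zigzag_seq :: "'a topology \<Rightarrow> 'a set \<Rightarrow> 'a set set \<Rightarrow> (nat \<Rightarrow> 'a set) \<Rightarrow> bool" where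
  "zigzag_seq M V E s \<longleftrightarrow> (\<forall>i. s i \<in> E) \<and>
     (\<forall>i. s i \<noteq> s (Suc i) \<and> (\<exists>F\<in>faces M V E. s i \<subseteq> F \<and> s (Suc i) \<subseteq> F)) \<and>
     (\<forall>i. \<forall>F\<in>faces M V E. \<forall>F'\<in>faces M V E.
        s i \<union> s (i + 1) \<subseteq> F \<longrightarrow> s (i + 1) \<union> s (i + 2) \<subseteq> F' \<longrightarrow> F \<noteq> F') \<and>
     (\<forall>i. s i \<inter> s (i + 2) \<inter> V = {})"

text \<open>
  The cyclic sequence given by a periodic sequence \<open>s\<close> is the set of all shifts of \<open>s\<close>. If \<open>n\<close> is the
  minimal period of \<open>s\<close>, this set has exactly \<open>n\<close> elements: one for each position in the cyclic
  sequence \<open>s 0, \<dots>, s (n - 1)\<close>.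
\<close>

definition cyclic :: "(nat \<Rightarrow> 'b) \<Rightarrow> (nat \<Rightarrow> 'b) set" where
  "cyclic s = {t. \<exists>k. t = (\<lambda>i. s (i + k))}"

definition min_period :: "(nat \<Rightarrow> 'b) \<Rightarrow> nat" where
  "min_period s = (LEAST n. 0 < n \<and> (\<forall>i. s (i + n) = s i))"

definition rev_seq :: "(nat \<Rightarrow> 'b) \<Rightarrow> nat \<Rightarrow> 'b" where
  "rev_seq s i = s (min_period s - 1 - i mod min_period s)"

definition zigzags :: "'a topology \<Rightarrow> 'a set \<Rightarrow> 'a set set \<Rightarrow> (nat \<Rightarrow> 'a set) set set" where
  "zigzags M V E = {cyclic s | s. zigzag_seq M V E s}"

definition reversed :: "(nat \<Rightarrow> 'b) set \<Rightarrow> (nat \<Rightarrow> 'b) set" where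
  "reversed Z = rev_seq ` Z"

definition z_orientation ::
  "'a topology \<Rightarrow> 'a set \<Rightarrow> 'a set set \<Rightarrow> (nat \<Rightarrow> 'a set) set set \<Rightarrow> bool" where
  "z_orientation M V E \<tau> \<longleftrightarrow>
     \<tau> \<subseteq> zigzags M V E \<and> (\<forall>Z\<in>zigzags M V E. Z \<in> \<tau> \<longleftrightarrow> reversed Z \<notin> \<tau>)"

section \<open>Types of edges, vertices and faces\<close>

text \<open>
  An occurrence of the edge \<open>e\<close> in a zigzag of \<open>\<tau>\<close> is a position of that cyclic sequence at which
  \<open>e\<close> stands; it is represented by the shift \<open>s\<close> that has \<open>e\<close> at index 1, so that \<open>s 0\<close> and \<open>s 2\<close>
  are the preceding and the following edge.
\<close>

definition occurrences :: "(nat \<Rightarrow> 'a set) set set \<Rightarrow> 'a set \<Rightarrow> (nat \<Rightarrow> 'a set) set" where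
  "occurrences \<tau> e = {s \<in> \<Union>\<tau>. s 1 = e}"

definition common_vertex :: "'a set \<Rightarrow> 'a set \<Rightarrow> 'a set \<Rightarrow> 'a" where
  "common_vertex V e e' = (THE v. v \<in> V \<and> v \<in> e \<and> v \<in> e')"

definition direction :: "'a set \<Rightarrow> (nat \<Rightarrow> 'a set) \<Rightarrow> 'a \<times> 'a" where
  "direction V s = (common_vertex V (s 0) (s 1), common_vertex V (s 1) (s 2))"

definition edge_type_I :: "'a set \<Rightarrow> (nat \<Rightarrow> 'a set) set set \<Rightarrow> 'a set \<Rightarrow> bool" where
  "edge_type_I V \<tau> e \<longleftrightarrow>
     (\<exists>s t. s \<noteq> t \<and> occurrences \<tau> e = {s, t} \<and> direction V t = prod.swap (direction V s))"

definition edge_type_II :: "'a set \<Rightarrow> (nat \<Rightarrow> 'a set) set set \<Rightarrow> 'a set \<Rightarrow> bool" where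
  "edge_type_II V \<tau> e \<longleftrightarrow>
     (\<exists>s t. s \<noteq> t \<and> occurrences \<tau> e = {s, t} \<and> direction V t = direction V s)"

definition vertex_type_I ::
  "'a set \<Rightarrow> 'a set set \<Rightarrow> (nat \<Rightarrow> 'a set) set set \<Rightarrow> 'a \<Rightarrow> bool" where
  "vertex_type_I V E \<tau> v \<longleftrightarrow> (\<forall>e\<in>E. v \<in> e \<longrightarrow> edge_type_I V \<tau> e)"

definition face_type_I ::
  "'a set \<Rightarrow> 'a set set \<Rightarrow> (nat \<Rightarrow> 'a set) set set \<Rightarrow> 'a set \<Rightarrow> bool" where
  "face_type_I V E \<tau> F \<longleftrightarrow>
     card {e \<in> E. e \<subseteq> F \<and> edge_type_I V \<tau> e} = 2 \<and>
     card {e \<in> E. e \<subseteq> F \<and> edge_type_II V \<tau> e} = 1"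

definition type_II_subgraph ::
  "'a set \<Rightarrow> 'a set set \<Rightarrow> (nat \<Rightarrow> 'a set) set set \<Rightarrow> 'a set" where
  "type_II_subgraph V E \<tau> =
     {v \<in> V. \<not> vertex_type_I V E \<tau> v} \<union> \<Union>{e \<in> E. edge_type_II V \<tau> e}"

end

theory Submission
  imports Defs
begin

text \<open>
  Zigzags matter only through one fact: no edge is of both types, so that every face has two edges
  of type I and one of type II. Passing from a face to the next one through a type I edge
  decomposes the faces into cycles. A face minus its type II edge and its vertices is a strip
  joining its two type I edges, which is parametrised such that consecutive strips fit
  together; hence a cycle of faces is the image of a rectangle, injective except that the two ends
  are glued, either directly or with a reflection. If no face of the cycle has a vertex of type I,
  this is a cylinder or a Moebius strip. Otherwise one side of the rectangle is collapsed to this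
  vertex, which lies in all faces of the cycle, and the result is a disk. Conversely, cylinder and
  Moebius strip retract onto a circle and are not contractible.
\<close>

section \<open>Models of the three surfaces\<close>

text \<open>All homeomorphisms come from one principle: two quotient maps on the same domain with
  the same fibres have homeomorphic targets. No inverse is constructed; it suffices to know which
  points of the rectangle \<open>band\<close> identifies. The rectangle without some of its sides is
  not compact, so continuity is shown on the closed rectangle and the quotient property is passed on
  to full preimages.

  Strips fit together because the type I edges are parametrised before the charts are made, and each
  triangle is swept by segments joining points of equal parameter on its two type I edges.
  Consecutive parametrisations take the common vertex of their edges at the same parameter 0 or 1,
  so one horizontal end of a strip is this vertex and the other lies on the type II edge.

  Two obstacles shape the rest. The walk through the faces might return to a face or an edge before
  it closes up; this is excluded by an argument on involutions without fixed points. The faces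
  around a type I vertex might form several cycles; this is excluded because a punctured disk is
  connected.\<close>

lemma quotient_map_restrict_compact:
  assumes "compact K" "continuous_map (top_of_set K) Y f" "Hausdorff_space Y" "S \<subseteq> K"
    and saturated: "\<And>x. \<lbrakk>x \<in> K; f x \<in> f ` S\<rbrakk> \<Longrightarrow> x \<in> S"
  shows "quotient_map (top_of_set S) (subtopology Y (f ` S)) f"
proof (rule continuous_closed_imp_quotient_map)
  have sub: "f ` S \<subseteq> topspace Y"
    using continuous_map_image_subset_topspace[OF assms(2)] assms(4) by auto
  have cont: "continuous_map (top_of_set S) Y f"
    using continuous_map_from_subtopology_mono[OF assms(2,4)] .
  then show "continuous_map (top_of_set S) (subtopology Y (f ` S)) f"
    by (simp add: continuous_map_in_subtopology)
  \<comment> \<open>A continuous map from a compact to a Hausdorff space is closed, and it remains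
    closed when restricted to a full preimage. This is the reason for the saturation hypothesis:
    \<open>S\<close> itself need not be compact.\<close>
  have "closed_map (top_of_set K) Y f"
    using continuous_imp_closed_map[OF assms(2) _ assms(3)] assms(1)
    by (simp add: compact_space_subtopology)
  then have "closed_map (subtopology (top_of_set K) S) (subtopology Y (f ` S)) f"
    by (rule closed_map_restriction) (use assms(4) saturated in auto)
  then show "closed_map (top_of_set S) (subtopology Y (f ` S)) f"
    using assms(4) by (simp add: subtopology_subtopology Int_absorb1)
  show "f ` topspace (top_of_set S) = topspace (subtopology Y (f ` S))"
    using sub by auto
qed

lemma quotient_map_lift:
  assumes "quotient_map X Y f" "continuous_map X Z h"
    and "\<And>x y. \<lbrakk>x \<in> topspace X; y \<in> topspace X; f x = f y\<rbrakk> \<Longrightarrow> h x = h y"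
  shows "\<exists>g. continuous_map Y Z g \<and> (\<forall>x\<in>topspace X. g (f x) = h x)"
proof (rule quotient_map_lift_exists[OF assms(1,2)])
  show "h x = h y" if "x \<in> topspace X" "y \<in> topspace X" "f x = f y" for x y
    using that by (rule assms(3))
qed auto

text \<open>Each quotient map factors through the other. The two factors are inverse to each other
  because every point of \<open>Y\<close> and of \<open>Z\<close> is the image of a point of
  \<open>X\<close>.\<close>

lemma quotient_maps_same_fibres_homeomorphic:
  assumes f: "quotient_map X Y f" and g: "quotient_map X Z g"
    and fibres: "\<And>p q. \<lbrakk>p \<in> topspace X; q \<in> topspace X\<rbrakk> \<Longrightarrow> f p = f q \<longleftrightarrow> g p = g q"
  shows "Y homeomorphic_space Z"
proof -
  obtain h where h: "continuous_map Y Z h" "\<And>x. x \<in> topspace X \<Longrightarrow> h (f x) = g x"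
    using quotient_map_lift[OF f quotient_imp_continuous_map[OF g]] fibres by metis
  obtain k where k: "continuous_map Z Y k" "\<And>x. x \<in> topspace X \<Longrightarrow> k (g x) = f x"
    using quotient_map_lift[OF g quotient_imp_continuous_map[OF f]] fibres by metis
  have "homeomorphic_maps Y Z h k"
    unfolding homeomorphic_maps_def
    using h k quotient_imp_surjective_map[OF f, symmetric] quotient_imp_surjective_map[OF g, symmetric] by auto
  then show ?thesis
    using homeomorphic_space_def by blast
qed

lemma cis_2pi_eq_iff:
  assumes "x \<in> {0..1}" "y \<in> {0..1}"
  shows "cis (2 * pi * x) = cis (2 * pi * y) \<longleftrightarrow> x = y \<or> {x, y} = {0, 1}"
proof -
  have "cis (2 * pi * x) = cis (2 * pi * y) \<longleftrightarrow> (\<exists>n::int. x - y = of_int n)"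
  proof -
    have "cis (2 * pi * x) = cis (2 * pi * y) \<longleftrightarrow> exp (\<i> * (2 * pi * x)) = exp (\<i> * (2 * pi * y))"
      by (simp add: cis_conv_exp)
    also have "\<dots> \<longleftrightarrow> (\<exists>n::int. \<i> * (2 * pi * x) = \<i> * (2 * pi * y) + (of_int (2 * n) * pi) * \<i>)"
      by (rule exp_eq)
    also have "\<dots> \<longleftrightarrow> (\<exists>n::int. x - y = of_int n)"
    proof (intro ex_cong1)
      fix n :: int
      have "\<i> * (2 * pi * x) = \<i> * (2 * pi * y) + (of_int (2 * n) * pi) * \<i> \<longleftrightarrow>
          2 * pi * x = 2 * pi * y + 2 * of_int n * pi"
        by (auto simp: complex_eq_iff algebra_simps)
      also have "\<dots> \<longleftrightarrow> (2 * pi) * (x - y) = (2 * pi) * of_int n"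
        by (auto simp: algebra_simps)
      finally show "(\<i> * (2 * pi * x) = \<i> * (2 * pi * y) + (of_int (2 * n) * pi) * \<i>) = (x - y = of_int n)"
        by simp
    qed
    finally show ?thesis .
  qed
  also have "\<dots> \<longleftrightarrow> x = y \<or> {x, y} = {0, 1}"
  proof
    assume "\<exists>n::int. x - y = of_int n"
    then obtain n :: int where n: "x - y = of_int n" ..
    then have "n \<in> {-1, 0, 1}" using assms by auto
    then show "x = y \<or> {x, y} = {0, 1}" using n assms by auto
  next
    assume "x = y \<or> {x, y} = {0, 1}"
    then show "\<exists>n::int. x - y = of_int n"
      by (auto simp: doubleton_eq_iff intro: exI[of _ 0] exI[of _ 1] exI[of _ "-1"])
  qed
  finally show ?thesis .
qed

lemma sphere_image_cis: "(\<lambda>x. cis (2 * pi * x)) ` {0..1} = sphere 0 1"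
proof
  show "(\<lambda>x. cis (2 * pi * x)) ` {0..1} \<subseteq> sphere 0 1"
    by (rule image_subsetI) simp
  show "sphere 0 1 \<subseteq> (\<lambda>x. cis (2 * pi * x)) ` {0..1}"
  proof
    fix z :: complex assume "z \<in> sphere 0 1"
    then have "cmod z = 1" by simp
    then have "(Re z)\<^sup>2 + (Im z)\<^sup>2 = 1"
      using cmod_power2[of z] by simp
    then obtain t where "0 \<le> t" "t < 2 * pi" "Re z = cos t" "Im z = sin t"
      using sincos_total_2pi by blast
    then show "z \<in> (\<lambda>x. cis (2 * pi * x)) ` {0..1}"
      by (intro image_eqI[of _ _ "t / (2 * pi)"]) (auto simp: complex_eq_iff)
  qed
qed

lemma strip_subset: "strip \<subseteq> {0..1} \<times> {0..1}"
  by (auto simp: strip_def)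

lemma homeomorphic_open_cylinder:
  assumes "quotient_map (top_of_set strip) Y f"
    and "\<And>p q. \<lbrakk>p \<in> strip; q \<in> strip\<rbrakk> \<Longrightarrow>
       f p = f q \<longleftrightarrow> p = q \<or> ({fst p, fst q} = {0, 1} \<and> snd p = snd q)"
  shows "Y homeomorphic_space open_cylinder"
proof (rule quotient_maps_same_fibres_homeomorphic[OF assms(1)])
  define g :: "real \<times> real \<Rightarrow> complex \<times> real" where "g = (\<lambda>(x, t). (cis (2 * pi * x), t))"
  have img: "g ` strip = sphere 0 1 \<times> {0<..<1}"
  proof -
    have "g = map_prod (\<lambda>x. cis (2 * pi * x)) id"
      by (auto simp: g_def)
    then show ?thesis
      by (simp add: strip_def map_prod_surj_on sphere_image_cis)
  qed
  have "quotient_map (top_of_set strip) (subtopology euclidean (g ` strip)) g"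
  proof (rule quotient_map_restrict_compact)
    show "compact ({0..1::real} \<times> {0..1::real})"
      by (intro compact_Times) auto
    show "continuous_map (top_of_set ({0..1} \<times> {0..1})) euclidean g"
      unfolding g_def case_prod_unfold
      by (auto intro!: continuous_intros)
  qed (use strip_subset in \<open>auto simp: g_def strip_def\<close>)
  moreover have "subtopology euclidean (g ` strip) = open_cylinder"
    unfolding img open_cylinder_def by (rule prod_topology_subtopology_eu[symmetric])
  ultimately show "quotient_map (top_of_set strip) open_cylinder g"
    by simp
  show "f p = f q \<longleftrightarrow> g p = g q" if "p \<in> topspace (top_of_set strip)" "q \<in> topspace (top_of_set strip)" for p q
  proof -
    have pq: "p \<in> strip" "q \<in> strip" using that by auto
    then have "fst p \<in> {0..1}" "fst q \<in> {0..1}" by (auto simp: strip_def)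
    then have "g p = g q \<longleftrightarrow> snd p = snd q \<and> (fst p = fst q \<or> {fst p, fst q} = {0, 1})"
      using cis_2pi_eq_iff by (simp add: g_def case_prod_unfold) blast
    then show ?thesis
      unfolding assms(2)[OF pq] prod_eq_iff by metis
  qed
qed

text \<open>The preimage of a set of classes is the union of these classes, and openness of that
  union is how the topology of \<open>open_moebius_strip\<close> is defined.\<close>

lemma quotient_map_moebius: "quotient_map (top_of_set strip) open_moebius_strip (\<lambda>p. moebius_rel `` {p})"
  unfolding quotient_map_def topspace_open_moebius_strip
proof (intro conjI allI impI)
  show "(\<lambda>p. moebius_rel `` {p}) ` topspace (top_of_set strip) = strip // moebius_rel"
    by (auto simp: quotient_def)
  fix \<U> assume U: "\<U> \<subseteq> strip // moebius_rel"
  have "{x \<in> topspace (top_of_set strip). moebius_rel `` {x} \<in> \<U>} = \<Union>\<U>"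
  proof (intro set_eqI iffI)
    fix x assume "x \<in> {x \<in> topspace (top_of_set strip). moebius_rel `` {x} \<in> \<U>}"
    then have "x \<in> strip" "moebius_rel `` {x} \<in> \<U>" by auto
    then show "x \<in> \<Union>\<U>"
      using equiv_class_self[OF equiv_moebius_rel] by (meson UnionI)
  next
    fix x assume "x \<in> \<Union>\<U>"
    then obtain A where A: "A \<in> \<U>" "x \<in> A" by blast
    then have "A \<in> strip // moebius_rel" using U by blast
    then obtain y where y: "y \<in> strip" "A = moebius_rel `` {y}" by (auto simp: quotient_def)
    have "A = moebius_rel `` {x}"
      using A y equiv_class_eq[OF equiv_moebius_rel, of y x] by auto
    moreover have "x \<in> strip"
      using A y by (auto simp: moebius_rel_def)
    ultimately show "x \<in> {x \<in> topspace (top_of_set strip). moebius_rel `` {x} \<in> \<U>}"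
      using A by auto
  qed
  then show "openin (top_of_set strip) {x \<in> topspace (top_of_set strip). moebius_rel `` {x} \<in> \<U>} =
      openin open_moebius_strip \<U>"
    using U by (simp add: openin_open_moebius_strip)
qed

lemma homeomorphic_open_moebius_strip:
  assumes "quotient_map (top_of_set strip) Y f"
    and "\<And>p q. \<lbrakk>p \<in> strip; q \<in> strip\<rbrakk> \<Longrightarrow>
       f p = f q \<longleftrightarrow> p = q \<or> ({fst p, fst q} = {0, 1} \<and> snd q = 1 - snd p)"
  shows "Y homeomorphic_space open_moebius_strip"
proof (rule quotient_maps_same_fibres_homeomorphic[OF assms(1) quotient_map_moebius])
  show "f p = f q \<longleftrightarrow> moebius_rel `` {p} = moebius_rel `` {q}"
    if "p \<in> topspace (top_of_set strip)" "q \<in> topspace (top_of_set strip)" for p q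
    using that assms(2)[of p q] eq_equiv_class_iff[OF equiv_moebius_rel, of p q]
    by (simp add: moebius_rel_def)
qed

lemma homeomorphic_open_disk:
  fixes f :: "real \<times> real \<Rightarrow> 'a"
  assumes "quotient_map (top_of_set ({0..1} \<times> {0..<1})) Y f"
    and "\<And>p q. \<lbrakk>p \<in> {0..1} \<times> {0..<1}; q \<in> {0..1} \<times> {0..<1}\<rbrakk> \<Longrightarrow>
       f p = f q \<longleftrightarrow> p = q \<or> (snd p = 0 \<and> snd q = 0) \<or> ({fst p, fst q} = {0, 1} \<and> snd p = snd q)"
  shows "Y homeomorphic_space open_disk"
proof (rule quotient_maps_same_fibres_homeomorphic[OF assms(1)])
  \<comment> \<open>Polar coordinates: the side \<open>t = 0\<close> collapses to the centre, and
    \<open>norm_g\<close> recovers \<open>t\<close> as the distance from it, so that only the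
    missing side \<open>t = 1\<close> would leave the open disk.\<close>
  define g :: "real \<times> real \<Rightarrow> complex" where "g = (\<lambda>(x, t). of_real t * cis (2 * pi * x))"
  let ?S = "{0..1::real} \<times> {0..<1::real}"
  have norm_g: "cmod (g p) = \<bar>snd p\<bar>" for p
    by (simp add: g_def case_prod_unfold norm_mult)
  have img: "g ` ?S = ball 0 1"
  proof
    show "g ` ?S \<subseteq> ball 0 1"
      using norm_g by auto
    show "ball 0 1 \<subseteq> g ` ?S"
    proof
      fix z :: complex assume z: "z \<in> ball 0 1"
      obtain x where x: "x \<in> {0..1}" "z = of_real (cmod z) * cis (2 * pi * x)"
      proof (cases "z = 0")
        case False
        then have "sgn z \<in> sphere 0 1" by (simp add: norm_sgn)
        then obtain x where "x \<in> {0..1}" "sgn z = cis (2 * pi * x)"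
          unfolding sphere_image_cis[symmetric] by blast
        then show thesis
          using that[of x] False by (metis norm_eq_zero nonzero_mult_div_cancel_left of_real_eq_0_iff sgn_eq times_divide_eq_right)
      qed (use that[of 0] in auto)
      then show "z \<in> g ` ?S"
        using z by (intro image_eqI[of _ _ "(x, cmod z)"]) (auto simp: g_def)
    qed
  qed
  have "quotient_map (top_of_set ?S) (subtopology euclidean (g ` ?S)) g"
  proof (rule quotient_map_restrict_compact)
    show "compact ({0..1::real} \<times> {0..1::real})"
      by (intro compact_Times) auto
    show "continuous_map (top_of_set ({0..1} \<times> {0..1})) euclidean g"
      unfolding g_def case_prod_unfold
      by (auto intro!: continuous_intros)
    show "p \<in> ?S" if "p \<in> {0..1} \<times> {0..1}" "g p \<in> g ` ?S" for p
      using that img norm_g[of p] by (auto simp: mem_Times_iff)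
  qed auto
  then show "quotient_map (top_of_set ?S) open_disk g"
    unfolding img open_disk_def .
  show "f p = f q \<longleftrightarrow> g p = g q" if "p \<in> topspace (top_of_set ?S)" "q \<in> topspace (top_of_set ?S)" for p q
  proof -
    have pq: "p \<in> ?S" "q \<in> ?S" using that by auto
    then have fst: "fst p \<in> {0..1}" "fst q \<in> {0..1}" by auto
    have "g p = g q \<Longrightarrow> snd p = snd q"
      using norm_g[of p] norm_g[of q] pq by auto
    moreover have "snd p = snd q \<Longrightarrow> g p = g q \<longleftrightarrow> snd p = 0 \<or> cis (2 * pi * fst p) = cis (2 * pi * fst q)"
      by (auto simp: g_def case_prod_unfold)
    ultimately have "g p = g q \<longleftrightarrow> snd p = snd q \<and> (snd p = 0 \<or> fst p = fst q \<or> {fst p, fst q} = {0, 1})"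
      using cis_2pi_eq_iff[OF fst] by blast
    then show ?thesis
      unfolding assms(2)[OF pq] prod_eq_iff by metis
  qed
qed

section \<open>Cylinder and Moebius strip are not disks\<close>

lemma not_homeomorphic_open_disk_if_retraction_circle:
  assumes "retraction_map X (top_of_set (sphere (0::complex) 1)) r"
  shows "\<not> X homeomorphic_space open_disk"
proof
  assume "X homeomorphic_space open_disk"
  then have "contractible_space X"
    using homeomorphic_space_contractibility[of X open_disk]
    by (simp add: open_disk_def convex_imp_contractible)
  then have "contractible_space (top_of_set (sphere (0::complex) 1))"
    using contractible_space_retraction_map_image[OF assms] by blast
  then show False
    by (simp add: contractible_sphere)
qed

lemma open_cylinder_not_open_disk: "\<not> open_cylinder homeomorphic_space open_disk"
proof (rule not_homeomorphic_open_disk_if_retraction_circle)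
  show "retraction_map open_cylinder (top_of_set (sphere 0 1)) fst"
    unfolding open_cylinder_def using ex_in_conv[of "{0<..<1::real}"]
    by (subst retraction_map_fst) (auto simp flip: null_topspace_iff_trivial)
qed

text \<open>The circle in question is the core of the strip. The map \<open>r\<close> forgets the
  height and winds the first coordinate around the circle, the map \<open>s\<close> runs along the
  core, and \<open>r\<close> undoes \<open>s\<close>.\<close>

lemma open_moebius_strip_not_open_disk: "\<not> open_moebius_strip homeomorphic_space open_disk"
proof -
  let ?C = "top_of_set (sphere (0::complex) 1)"
  let ?c = "\<lambda>x::real. cis (2 * pi * x)"
  let ?m = "\<lambda>p. moebius_rel `` {p}"
  have cont_c: "continuous_map (top_of_set strip) ?C (\<lambda>p. ?c (fst p))"
    by (auto intro!: continuous_intros)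
  have fib: "?c (fst p) = ?c (fst q)" if "p \<in> strip" "q \<in> strip" "?m p = ?m q" for p q
  proof -
    have "(p, q) \<in> moebius_rel"
      using eq_equiv_class_iff[OF equiv_moebius_rel that(1,2)] that(3) by blast
    then have "fst p = fst q \<or> {fst p, fst q} = {0, 1}"
      unfolding moebius_rel_def by blast
    moreover have "fst p \<in> {0..1}" "fst q \<in> {0..1}"
      using that by (auto simp: strip_def)
    ultimately show ?thesis
      using cis_2pi_eq_iff by blast
  qed
  obtain r where r: "continuous_map open_moebius_strip ?C r" "\<And>p. p \<in> strip \<Longrightarrow> r (?m p) = ?c (fst p)"
  proof -
    have "\<exists>r. continuous_map open_moebius_strip ?C r \<and> (\<forall>p\<in>topspace (top_of_set strip). r (?m p) = ?c (fst p))"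
      by (rule quotient_map_lift[OF quotient_map_moebius cont_c]) (rule fib; simp)
    then show thesis using that by auto
  qed
  have quo: "quotient_map (top_of_set {0..1}) ?C ?c"
    by (rule T1_Spaces.continuous_imp_quotient_map)
      (use sphere_image_cis in \<open>auto intro!: continuous_intros simp: compact_space_subtopology Hausdorff_space_subtopology\<close>)
  \<comment> \<open>Height 1/2 is the only one fixed by the reflection \<open>t\<close> to
    \<open>1 - t\<close>; hence this horizontal segment closes up after a single turn.\<close>
  have mid: "(x, 1/2) \<in> strip" if "x \<in> {0..1}" for x
    using that by (auto simp: strip_def)
  have cont_s: "continuous_map (top_of_set {0..1}) open_moebius_strip (?m \<circ> (\<lambda>x. (x, 1/2)))"
    by (rule continuous_map_compose[OF _ quotient_imp_continuous_map[OF quotient_map_moebius]])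
      (use mid in \<open>auto intro!: continuous_intros\<close>)
  have fib_s: "(?m \<circ> (\<lambda>x. (x, 1/2))) x = (?m \<circ> (\<lambda>x. (x, 1/2))) y" if "x \<in> {0..1}" "y \<in> {0..1}" "?c x = ?c y" for x y
  proof -
    have "((x, 1/2), (y, 1/2)) \<in> moebius_rel"
      using cis_2pi_eq_iff[OF that(1,2)] that(3) mid[OF that(1)] mid[OF that(2)]
      unfolding moebius_rel_def by auto
    then show ?thesis
      using equiv_class_eq[OF equiv_moebius_rel] by simp
  qed
  obtain s where s: "continuous_map ?C open_moebius_strip s"
    "\<And>x. x \<in> {0..1} \<Longrightarrow> s (?c x) = ?m (x, 1/2)"
  proof -
    have "\<exists>s. continuous_map ?C open_moebius_strip s \<and>
        (\<forall>x\<in>topspace (top_of_set {0..1}). s (?c x) = (?m \<circ> (\<lambda>x. (x, 1/2))) x)"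
      by (rule quotient_map_lift[OF quo cont_s]) (rule fib_s; simp)
    then show thesis using that by auto
  qed
  have "r (s z) = z" if "z \<in> sphere 0 1" for z
  proof -
    obtain x where "x \<in> {0..1}" "z = ?c x"
      using \<open>z \<in> sphere 0 1\<close> unfolding sphere_image_cis[symmetric] by blast
    then show ?thesis
      using s(2) r(2)[OF mid] by simp
  qed
  then have "retraction_map open_moebius_strip ?C r"
    unfolding retraction_map_def retraction_maps_def using r s by auto
  then show ?thesis
    by (rule not_homeomorphic_open_disk_if_retraction_circle)
qed

section \<open>Sweeping out a triangle\<close>

lemma std_triangle_eq: "std_triangle = {z. 0 \<le> Re z \<and> 0 \<le> Im z \<and> Re z + Im z \<le> 1}"
proof -
  have "std_triangle = convex hull (insert 0 Basis)"
    by (simp add: std_triangle_def Basis_complex_def)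
  then show ?thesis
    unfolding std_simplex by (simp add: Basis_complex_def inner_complex_def add.commute)
qed

lemma interior_std_triangle_eq: "interior std_triangle = {z. 0 < Re z \<and> 0 < Im z \<and> Re z + Im z < 1}"
proof -
  have "interior std_triangle = interior (convex hull (insert 0 Basis))"
    by (simp add: std_triangle_def Basis_complex_def)
  then show ?thesis
    unfolding interior_std_simplex by (simp add: Basis_complex_def inner_complex_def add.commute)
qed

lemma compact_std_triangle: "compact std_triangle"
  unfolding std_triangle_def by (intro finite_imp_compact_convex_hull) auto

definition bottom_side :: "complex set" where
  "bottom_side = {z \<in> std_triangle. Im z = 0}"

definition left_side :: "complex set" where
  "left_side = {z \<in> std_triangle. Re z = 0}"

definition slanted_side :: "complex set" where
  "slanted_side = {z \<in> std_triangle. Re z + Im z = 1}"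

lemmas side_defs = bottom_side_def left_side_def slanted_side_def std_triangle_eq

lemma std_triangle_eq_sides:
  "std_triangle = interior std_triangle \<union> (bottom_side \<union> left_side \<union> slanted_side)"
  unfolding interior_std_triangle_eq unfolding side_defs by auto

lemma bottom_side_eq: "bottom_side = closed_segment 0 1"
proof -
  have "z \<in> closed_segment 0 1 \<longleftrightarrow> z \<in> bottom_side" for z
    by (auto simp: in_segment side_defs complex_eq_iff intro!: exI[of _ "Re z"])
  then show ?thesis by blast
qed

lemma left_side_eq: "left_side = closed_segment \<i> 0"
proof -
  have "z \<in> closed_segment 0 \<i> \<longleftrightarrow> z \<in> left_side" for z
    by (auto simp: in_segment side_defs complex_eq_iff intro!: exI[of _ "Im z"])
  then show ?thesis by (metis closed_segment_commute subsetI subset_antisym)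
qed

lemma slanted_side_eq: "slanted_side = closed_segment 1 \<i>"
proof -
  have "z \<in> closed_segment 1 \<i> \<longleftrightarrow> z \<in> slanted_side" for z
    by (auto simp: in_segment side_defs complex_eq_iff intro!: exI[of _ "Im z"])
  then show ?thesis by blast
qed

text \<open>The affine map that permutes the corners by 0 to 1, 1 to \<i>, \<i> to 0. With
  \<open>flip_triangle\<close>, which exchanges 1 and \<i>, it generates the six symmetries of the
  triangle.\<close>

definition rotate_triangle :: "complex \<Rightarrow> complex" where
  "rotate_triangle z = Complex (1 - Re z - Im z) (Re z)"

definition flip_triangle :: "complex \<Rightarrow> complex" where
  "flip_triangle z = Complex (Im z) (Re z)"

lemma continuous_on_Complex [continuous_intros]:
  assumes "continuous_on S f" "continuous_on S g"
  shows "continuous_on S (\<lambda>x. Complex (f x) (g x))"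
  unfolding Complex_eq using assms by (intro continuous_intros)

lemma image_eq_if_inverse:
  assumes "\<And>z. z \<in> A \<Longrightarrow> f z \<in> B" "\<And>z. z \<in> B \<Longrightarrow> g z \<in> A" "\<And>z. f (g z) = z"
  shows "f ` A = B"
  using assms by (metis image_subsetI rev_image_eqI subsetI subset_antisym)

lemma rotate_triangle_inverse: "rotate_triangle (rotate_triangle (rotate_triangle z)) = z"
  by (simp add: rotate_triangle_def complex_eq_iff)

lemma rotate_triangle_image:
  "rotate_triangle ` std_triangle = std_triangle"
  "rotate_triangle ` interior std_triangle = interior std_triangle"
  "rotate_triangle ` bottom_side = slanted_side"
  "rotate_triangle ` slanted_side = left_side"
  "rotate_triangle ` left_side = bottom_side"
  unfolding interior_std_triangle_eq
  by (rule image_eq_if_inverse[where g = "rotate_triangle \<circ> rotate_triangle"];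
      force simp: rotate_triangle_inverse rotate_triangle_def side_defs)+

lemma flip_triangle_image:
  "flip_triangle ` std_triangle = std_triangle"
  "flip_triangle ` interior std_triangle = interior std_triangle"
  "flip_triangle ` bottom_side = left_side"
  "flip_triangle ` left_side = bottom_side"
  "flip_triangle ` slanted_side = slanted_side"
  unfolding interior_std_triangle_eq
  by (rule image_eq_if_inverse[where g = flip_triangle];
      force simp: flip_triangle_def side_defs complex_eq_iff)+

definition triangle_map :: "'a topology \<Rightarrow> (complex \<Rightarrow> 'a) \<Rightarrow> bool" where
  "triangle_map M h \<longleftrightarrow> continuous_map (top_of_set std_triangle) M h \<and> inj_on h std_triangle"

lemma triangle_map_compose:
  assumes "triangle_map M h" "continuous_on std_triangle f" "f ` std_triangle = std_triangle" "inj f"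
  shows "triangle_map M (h \<circ> f)"
  unfolding triangle_map_def
proof
  show "continuous_map (top_of_set std_triangle) M (h \<circ> f)"
    by (rule continuous_map_compose[of _ "top_of_set std_triangle"])
      (use assms in \<open>auto simp: triangle_map_def\<close>)
  show "inj_on (h \<circ> f) std_triangle"
    using assms by (metis comp_inj_on inj_on_subset subset_UNIV triangle_map_def)
qed

lemma triangle_map_rotate: "triangle_map M h \<Longrightarrow> triangle_map M (h \<circ> rotate_triangle)"
proof (erule triangle_map_compose)
  show "continuous_on std_triangle rotate_triangle"
    unfolding rotate_triangle_def by (intro continuous_intros)
  show "inj rotate_triangle"
    by (metis injI rotate_triangle_inverse)
qed (rule rotate_triangle_image)

lemma triangle_map_flip: "triangle_map M h \<Longrightarrow> triangle_map M (h \<circ> flip_triangle)"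
proof (erule triangle_map_compose)
  show "continuous_on std_triangle flip_triangle"
    unfolding flip_triangle_def by (intro continuous_intros)
  show "inj flip_triangle"
    by (simp add: inj_on_def flip_triangle_def complex_eq_iff)
qed (rule flip_triangle_image)

text \<open>There are six ordered pairs of distinct sides, and each is carried to (bottom, left) by
  precomposing \<open>h\<close> with one of the six symmetries. The third side differs from both
  because \<open>h\<close> is injective.\<close>

lemma triangle_map_choose_sides:
  assumes h: "triangle_map M h" and "e \<noteq> e'"
    and sides: "{e, e'} \<subseteq> {h ` bottom_side, h ` left_side, h ` slanted_side}"
  obtains g where "triangle_map M g" "g ` std_triangle = h ` std_triangle"
    "g ` interior std_triangle = h ` interior std_triangle"
    "g ` bottom_side = e" "g ` left_side = e'"
    "g ` slanted_side \<in> {h ` bottom_side, h ` left_side, h ` slanted_side} - {e, e'}"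
proof -
  let ?r = rotate_triangle and ?f = flip_triangle
  let ?P = "\<lambda>g. triangle_map M g \<and> g ` std_triangle = h ` std_triangle \<and>
    g ` interior std_triangle = h ` interior std_triangle"
  let ?Q = "\<lambda>g. g ` bottom_side = e \<and> g ` left_side = e' \<and>
    g ` slanted_side \<in> {h ` bottom_side, h ` left_side, h ` slanted_side} - {e, e'}"
  have inj: "inj_on h std_triangle"
    using h by (simp add: triangle_map_def)
  have "bottom_side \<subseteq> std_triangle" "left_side \<subseteq> std_triangle" "slanted_side \<subseteq> std_triangle"
    by (auto simp: bottom_side_def left_side_def slanted_side_def)
  moreover have "1 \<in> bottom_side - left_side" "1 \<in> slanted_side - left_side" "0 \<in> bottom_side - slanted_side"
    by (auto simp: side_defs)
  ultimately have "h ` bottom_side \<noteq> h ` left_side" "h ` bottom_side \<noteq> h ` slanted_side"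
    "h ` slanted_side \<noteq> h ` left_side"
    using inj_on_image_eq_iff[OF inj] by auto
  note neq = this this[symmetric]
  have P: "?P h" "?P (h \<circ> ?r)" "?P (h \<circ> ?r \<circ> ?r)" "?P (h \<circ> ?f)" "?P (h \<circ> ?r \<circ> ?f)" "?P (h \<circ> ?r \<circ> ?r \<circ> ?f)"
    using h by (simp_all only: triangle_map_rotate triangle_map_flip image_comp[symmetric]
        rotate_triangle_image flip_triangle_image simp_thms)
  have "e = h ` bottom_side \<and> e' = h ` left_side \<or> e = h ` bottom_side \<and> e' = h ` slanted_side \<or>
    e = h ` left_side \<and> e' = h ` bottom_side \<or> e = h ` left_side \<and> e' = h ` slanted_side \<or>
    e = h ` slanted_side \<and> e' = h ` bottom_side \<or> e = h ` slanted_side \<and> e' = h ` left_side"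
    using sides \<open>e \<noteq> e'\<close> by (metis insert_subset insertE singletonD)
  then have "\<exists>g. ?P g \<and> ?Q g"
  proof (elim disjE conjE)
    assume "e = h ` bottom_side" "e' = h ` left_side"
    then show ?thesis
      using P(1) neq by (intro exI[of _ h]) simp
  next
    assume "e = h ` bottom_side" "e' = h ` slanted_side"
    then show ?thesis
      using P(5) neq by (intro exI[of _ "h \<circ> ?r \<circ> ?f"]) (simp only: image_comp[symmetric] rotate_triangle_image
          flip_triangle_image Diff_iff insert_iff empty_iff simp_thms)
  next
    assume "e = h ` left_side" "e' = h ` bottom_side"
    then show ?thesis
      using P(4) neq by (intro exI[of _ "h \<circ> ?f"]) (simp only: image_comp[symmetric] rotate_triangle_image
          flip_triangle_image Diff_iff insert_iff empty_iff simp_thms)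
  next
    assume "e = h ` left_side" "e' = h ` slanted_side"
    then show ?thesis
      using P(3) neq by (intro exI[of _ "h \<circ> ?r \<circ> ?r"]) (simp only: image_comp[symmetric] rotate_triangle_image
          flip_triangle_image Diff_iff insert_iff empty_iff simp_thms)
  next
    assume "e = h ` slanted_side" "e' = h ` bottom_side"
    then show ?thesis
      using P(2) neq by (intro exI[of _ "h \<circ> ?r"]) (simp only: image_comp[symmetric] rotate_triangle_image
          flip_triangle_image Diff_iff insert_iff empty_iff simp_thms)
  next
    assume "e = h ` slanted_side" "e' = h ` left_side"
    then show ?thesis
      using P(6) neq by (intro exI[of _ "h \<circ> ?r \<circ> ?r \<circ> ?f"]) (simp only: image_comp[symmetric] rotate_triangle_image
          flip_triangle_image Diff_iff insert_iff empty_iff simp_thms)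
  qed
  then show thesis
    using that by blast
qed

text \<open>The arc \<open>q\<close> and the triangle \<open>h\<close> parametrise the same side
  independently. Here \<open>a\<close> is the transition from one to the other: the inverse of
  \<open>h\<close> applied to \<open>q\<close>. A continuous injection of the unit interval into
  itself that fixes 0 is increasing, and it reaches 1 only at the end.\<close>

lemma side_parameter:
  assumes h: "triangle_map M h" and M: "Hausdorff_space M"
    and q: "continuous_map (top_of_set {0..1::real}) M q" "inj_on q {0..1}"
      "q ` {0..1} = h ` bottom_side" "q 0 = h 0"
  obtains a where "continuous_on {0..1} a" "strict_mono_on {0..1} a" "a 0 = 0" "a 1 = 1"
    "\<And>t. t \<in> {0..1} \<Longrightarrow> q t = h (of_real (a t))"
proof -
  have "embedding_map (top_of_set std_triangle) M h"
    by (rule continuous_imp_embedding_map)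
      (use h M compact_std_triangle in \<open>auto simp: triangle_map_def compact_space_subtopology\<close>)
  then obtain k where k: "continuous_map (subtopology M (h ` std_triangle)) (top_of_set std_triangle) k"
    "\<And>z. z \<in> std_triangle \<Longrightarrow> k (h z) = z"
    by (auto simp: embedding_map_def homeomorphic_map_maps homeomorphic_maps_def)
  have bottom: "bottom_side \<subseteq> std_triangle" "0 \<in> bottom_side" "1 \<in> bottom_side"
    by (auto simp: side_defs)
  define a where "a t = Re (k (q t))" for t
  have kq: "k (q t) \<in> bottom_side" "h (k (q t)) = q t" if "t \<in> {0..1}" for t
  proof -
    have "q t \<in> h ` bottom_side" using q(3) that by blast
    then show "k (q t) \<in> bottom_side" "h (k (q t)) = q t"
      using k(2) bottom(1) by auto
  qed
  have real: "of_real (a t) = k (q t)" if "t \<in> {0..1}" for t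
    using kq(1)[OF that] by (simp add: a_def bottom_side_def complex_eq_iff)
  have a: "q t = h (of_real (a t))" "a t \<in> {0..1}" if "t \<in> {0..1}" for t
    using kq[OF that] real[OF that] by (auto simp: a_def side_defs)
  have "continuous_map (top_of_set {0..1}) (subtopology M (h ` std_triangle)) q"
    using q(1,3) bottom(1) by (auto simp: continuous_map_in_subtopology)
  then have "continuous_map (top_of_set {0..1}) (top_of_set std_triangle) (k \<circ> q)"
    using k(1) continuous_map_compose by blast
  then have cont: "continuous_on {0..1} a"
    unfolding a_def by (auto simp: o_def intro!: continuous_intros)
  have inj: "inj_on a {0..1}"
    using q(2) a(1) by (metis inj_on_def)
  have a0: "a 0 = 0"
    using q(4) k(2)[of 0] bottom by (simp add: a_def subset_iff)
  obtain u where u: "u \<in> {0..1}" "a u = 1"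
  proof -
    have "h 1 \<in> q ` {0..1}" using q(3) bottom by blast
    then obtain u where "u \<in> {0..1}" "h 1 = q u" by blast
    then show thesis
      using that[of u] k(2)[of 1] bottom by (metis a_def one_complex.simps(1) subsetD)
  qed
  \<comment> \<open>If \<open>a y < a x\<close>, monotonicity of the injection on the interval from
    0 to \<open>y\<close> puts \<open>a x\<close> strictly between \<open>a 0 = 0\<close> and
    \<open>a y\<close>, or else below 0.\<close>
  have mono: "a x < a y" if "x \<in> {0..1}" "y \<in> {0..1}" "x < y" for x y
  proof (rule ccontr)
    assume "\<not> a x < a y"
    then have "a y < a x"
      using inj that by (metis inj_onD linorder_neqE_linordered_idom less_irrefl)
    then have "x \<noteq> 0" "y \<noteq> 0" using a0 a(2)[OF that(2)] that by auto
    then have "0 < x" "inj_on a {0..y}" "continuous_on {0..y} a"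
      using that inj cont by (auto intro: inj_on_subset continuous_on_subset)
    then have "(a 0 < a x \<and> a x < a y) \<or> (a y < a x \<and> a x < a 0)"
      using continuous_inj_imp_mono[of 0 x y a] that by blast
    then show False
      using a0 a(2)[OF that(1)] \<open>a y < a x\<close> by auto
  qed
  \<comment> \<open>Otherwise \<open>a 1\<close> would exceed \<open>a u = 1\<close>.\<close>
  then have "u = 1"
    using mono[of u 1] u a(2)[of 1] by (cases "u < 1") auto
  then have "a 1 = 1" using u(2) by simp
  then show thesis
    using that[OF cont strict_mono_onI a0 _ a(1)] mono by blast
qed

text \<open>The segments from \<open>(a t, 0)\<close> to \<open>(0, b t)\<close> sweep out the triangle once.\<close>

lemma bij_betw_sweep:
  fixes a b :: "real \<Rightarrow> real"
  assumes a: "continuous_on {0..1} a" "strict_mono_on {0..1} a" "a 0 = 0" "a 1 = 1"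
    and b: "continuous_on {0..1} b" "strict_mono_on {0..1} b" "b 0 = 0" "b 1 = 1"
  shows "bij_betw (\<lambda>(s::real, t::real). Complex ((1 - s) * a t) (s * b t)) ({0<..<1} \<times> {0<..<1}) (interior std_triangle)"
proof -
  let ?g = "\<lambda>(s::real, t::real). Complex ((1 - s) * a t) (s * b t)"
  let ?Q = "{0<..<1::real} \<times> {0<..<1::real}"
  have mono_a: "x < y \<Longrightarrow> 0 \<le> x \<Longrightarrow> y \<le> 1 \<Longrightarrow> a x < a y"
    and mono_b: "x < y \<Longrightarrow> 0 \<le> x \<Longrightarrow> y \<le> 1 \<Longrightarrow> b x < b y" for x y
    using a(2) b(2) by (auto simp: strict_mono_on_def)
  have bounds: "0 < a t" "a t < 1" "0 < b t" "b t < 1" if "0 < t" "t < 1" for t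
    using mono_a[of 0 t] mono_a[of t 1] mono_b[of 0 t] mono_b[of t 1] that a b by auto
  \<comment> \<open>Both intercepts grow with \<open>t\<close>. If the segments for
    \<open>t < t'\<close> met, equal real parts would force \<open>s < s'\<close> and equal
    imaginary parts \<open>s' < s\<close>.\<close>
  have no_overlap: False if "t < t'" "0 < t" "t' < 1" "0 < s" "s < 1" "0 < s'" "s' < 1"
      "(1 - s) * a t = (1 - s') * a t'" "s * b t = s' * b t'" for s s' t t'
  proof -
    have pos: "0 < a t'" "0 < b t'"
      using bounds[of t'] that by auto
    have "(1 - s') * a t' < (1 - s) * a t'"
      unfolding \<open>(1 - s) * a t = (1 - s') * a t'\<close>[symmetric] using mono_a[of t t'] that(1-3,5) by simp
    then have "1 - s' < 1 - s"
      using pos(1) by (rule mult_right_less_imp_less[OF _ less_imp_le])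
    moreover have "s' * b t' < s * b t'"
      unfolding \<open>s * b t = s' * b t'\<close>[symmetric] using mono_b[of t t'] that(1-4) by simp
    then have "s' < s"
      using pos(2) by (rule mult_right_less_imp_less[OF _ less_imp_le])
    ultimately show False by simp
  qed
  have "inj_on ?g ?Q"
  proof (rule inj_onI)
    fix p p' assume "p \<in> ?Q" "p' \<in> ?Q" "?g p = ?g p'"
    moreover obtain s t s' t' where p: "p = (s, t)" "p' = (s', t')"
      by (meson surj_pair)
    ultimately have *: "0 < s" "s < 1" "0 < t" "t < 1" "0 < s'" "s' < 1" "0 < t'" "t' < 1"
      and eq: "(1 - s) * a t = (1 - s') * a t'" "s * b t = s' * b t'" by auto
    have "t = t'"
      using no_overlap[of t t' s s'] no_overlap[of t' t s' s] * eq by (cases t t' rule: linorder_cases) auto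
    then show "p = p'"
      using eq(2) bounds[of t] * p by auto
  qed
  moreover have "?g ` ?Q = interior std_triangle"
  proof
    show "?g ` ?Q \<subseteq> interior std_triangle"
    proof clarify
      fix s t :: real assume *: "s \<in> {0<..<1}" "t \<in> {0<..<1}"
      have "(1 - s) * a t + s * b t < (1 - s) * 1 + s * 1"
        by (intro add_strict_mono mult_strict_left_mono) (use * bounds[of t] in auto)
      then have "(1 - s) * a t + s * b t < 1"
        by simp
      then show "Complex ((1 - s) * a t) (s * b t) \<in> interior std_triangle"
        using * bounds[of t] by (simp add: interior_std_triangle_eq)
    qed
    show "interior std_triangle \<subseteq> ?g ` ?Q"
    proof
      fix z assume "z \<in> interior std_triangle"
      then obtain x y where z: "z = Complex x y" "0 < x" "0 < y" "x + y < 1"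
        by (cases z) (auto simp: interior_std_triangle_eq)
      obtain u where u: "0 \<le> u" "u \<le> 1" "a u = x"
        using IVT'[of a 0 x 1] a z by auto
      then have "u \<noteq> 0" "u \<noteq> 1" using a z by auto
      \<comment> \<open>The point \<open>(x, y)\<close> lies on the segment for \<open>t\<close> iff
        \<open>x / a t + y / b t = 1\<close>; \<open>?F t = 0\<close> is this equation without
        denominators. At \<open>u\<close>, where \<open>a u = x\<close>, its value is
        \<open>x * y\<close>, which is positive; at 1 it is \<open>x + y - 1\<close>, which is
        negative.\<close>
      let ?F = "\<lambda>t. x * b t + y * a t - a t * b t"
      have "\<exists>t. u \<le> t \<and> t \<le> 1 \<and> ?F t = 0"
      proof (rule IVT2')
        show "?F 1 \<le> 0" "0 \<le> ?F u" "u \<le> 1" using a b z u by auto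
        show "continuous_on {u..1} ?F"
          using u by (intro continuous_intros continuous_on_subset[OF a(1)] continuous_on_subset[OF b(1)]) auto
      qed
      then obtain t where t: "u \<le> t" "t \<le> 1" "?F t = 0" by blast
      then have "t \<noteq> 1" using a b z by auto
      then have t01: "0 < t" "t < 1" using t u \<open>u \<noteq> 0\<close> by auto
      define s where "s = y / b t"
      have s: "s * b t = y" "(1 - s) * a t = x" "0 < s"
        using bounds[OF t01] t(3) z by (auto simp: s_def field_simps)
      then have "0 < 1 - s"
        using bounds(1)[OF t01] z by (metis zero_less_mult_pos2)
      then show "z \<in> ?g ` ?Q"
        using s t01 z by (intro image_eqI[of _ _ "(s, t)"]) auto
    qed
  qed
  ultimately show ?thesis
    by (simp add: bij_betw_def)
qed

text \<open>The parametrisations of two sides are prescribed and become the vertical sides of the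
  square. Two triangles with a common edge therefore receive maps that agree on it as soon as the
  same \<open>q\<close> is used for both. The corner common to the two sides is blown up to the side
  \<open>t = 0\<close>, and the third side of the triangle is traced by
  \<open>t = 1\<close>.\<close>

lemma triangle_sweep:
  assumes h: "triangle_map M h" and M: "Hausdorff_space M"
    and q: "continuous_map (top_of_set {0..1::real}) M q" "inj_on q {0..1}"
      "q ` {0..1} = h ` bottom_side" "q 0 = h 0"
    and q': "continuous_map (top_of_set {0..1::real}) M q'" "inj_on q' {0..1}"
      "q' ` {0..1} = h ` left_side" "q' 0 = h 0"
  obtains \<phi> where "continuous_map (top_of_set ({0..1::real} \<times> {0..1::real})) M \<phi>"
    "\<And>t. t \<in> {0..1} \<Longrightarrow> \<phi> (0, t) = q t" "\<And>t. t \<in> {0..1} \<Longrightarrow> \<phi> (1, t) = q' t"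
    "\<And>s. s \<in> {0..1} \<Longrightarrow> \<phi> (s, 0) = q 0" "\<And>s. s \<in> {0..1} \<Longrightarrow> \<phi> (s, 1) \<in> h ` slanted_side"
    "bij_betw \<phi> ({0<..<1} \<times> {0<..<1}) (h ` interior std_triangle)"
proof -
  obtain a where a: "continuous_on {0..1} a" "strict_mono_on {0..1} a" "a 0 = 0" "a 1 = 1"
    "\<And>t. t \<in> {0..1} \<Longrightarrow> q t = h (of_real (a t))"
    using side_parameter[OF h M q] by blast
  \<comment> \<open>The flip exchanges left and bottom side and fixes the corner 0, so that
    \<open>side_parameter\<close> also yields the transition on the left side.\<close>
  have flip: "(h \<circ> flip_triangle) ` bottom_side = h ` left_side" "(h \<circ> flip_triangle) 0 = h 0"
    by (simp_all only: image_comp[symmetric] flip_triangle_image)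
      (simp add: flip_triangle_def zero_complex.code)
  obtain b where b: "continuous_on {0..1} b" "strict_mono_on {0..1} b" "b 0 = 0" "b 1 = 1"
    "\<And>t. t \<in> {0..1} \<Longrightarrow> q' t = (h \<circ> flip_triangle) (of_real (b t))"
    using side_parameter[OF triangle_map_flip[OF h] M q'(1,2), unfolded flip, OF q'(3,4)] by blast
  let ?g = "\<lambda>(s::real, t::real). Complex ((1 - s) * a t) (s * b t)"
  have bounds: "0 \<le> a t \<and> a t \<le> 1 \<and> 0 \<le> b t \<and> b t \<le> 1" if "t \<in> {0..1}" for t
    using strict_mono_onD[OF a(2), of 0 t] strict_mono_onD[OF a(2), of t 1]
      strict_mono_onD[OF b(2), of 0 t] strict_mono_onD[OF b(2), of t 1] that a(3,4) b(3,4)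
    by (cases "t = 0"; cases "t = 1") auto
  have g_in: "?g p \<in> std_triangle" if p: "p \<in> {0..1} \<times> {0..1}" for p
  proof -
    obtain s t where st: "p = (s, t)" "s \<in> {0..1}" "t \<in> {0..1}" using p by auto
    have "(1 - s) * a t + s * b t \<le> (1 - s) * 1 + s * 1"
      by (intro add_mono mult_left_mono) (use st bounds[of t] in auto)
    then have "(1 - s) * a t + s * b t \<le> 1"
      by simp
    then show ?thesis
      using st bounds[of t] by (simp add: std_triangle_eq)
  qed
  have "continuous_on ({0..1} \<times> {0..1}) ?g"
    unfolding case_prod_unfold
    by (intro continuous_intros continuous_on_compose2[OF a(1)] continuous_on_compose2[OF b(1)]) auto
  then have "continuous_map (top_of_set ({0..1} \<times> {0..1})) (top_of_set std_triangle) ?g"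
    using g_in by auto
  then have "continuous_map (top_of_set ({0..1} \<times> {0..1})) M (h \<circ> ?g)"
    using h continuous_map_compose unfolding triangle_map_def by blast
  moreover have "(h \<circ> ?g) (0, t) = q t" if "t \<in> {0..1}" for t
    using a(5)[OF that] by (simp add: complex_of_real_def)
  moreover have "(h \<circ> ?g) (1, t) = q' t" if "t \<in> {0..1}" for t
    using b(5)[OF that] by (simp add: flip_triangle_def)
  moreover have "(h \<circ> ?g) (s, 0) = q 0" for s
    using a(3) b(3) q(4) by (simp add: zero_complex.code)
  moreover have "(h \<circ> ?g) (s, 1) \<in> h ` slanted_side" if "s \<in> {0..1}" for s
    using that a(4) b(4) by (auto simp: side_defs)
  moreover have "bij_betw (h \<circ> ?g) ({0<..<1} \<times> {0<..<1}) (h ` interior std_triangle)"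
  proof (rule bij_betw_trans[OF bij_betw_sweep[OF a(1-4) b(1-4)]])
    show "bij_betw h (interior std_triangle) (h ` interior std_triangle)"
      using h interior_subset unfolding triangle_map_def
      by (metis bij_betw_imageI inj_on_subset)
  qed
  ultimately show thesis
    using that[of "h \<circ> ?g"] by blast
qed

section \<open>Alternating cycles\<close>

definition other_element :: "'b set \<Rightarrow> 'b \<Rightarrow> 'b" where
  "other_element X x = (THE y. y \<in> X \<and> y \<noteq> x)"

lemma other_element:
  assumes "card X = 2" "x \<in> X"
  shows "other_element X x \<in> X" "other_element X x \<noteq> x" "other_element X (other_element X x) = x"
    "y \<in> X \<Longrightarrow> y = x \<or> y = other_element X x"
proof -
  obtain z where X: "X = {x, z}" "z \<noteq> x"
    using assms by (auto simp: card_2_iff)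
  then have z: "other_element X x = z"
    unfolding other_element_def by (intro the_equality) auto
  moreover have "other_element X z = x"
    unfolding other_element_def using X by (intro the_equality) auto
  ultimately show "other_element X x \<in> X" "other_element X x \<noteq> x"
    "other_element X (other_element X x) = x" "y \<in> X \<Longrightarrow> y = x \<or> y = other_element X x"
    using X by auto
qed

text \<open>
  Two involutions without fixed points generate a dihedral group. If \<open>\<iota>\<close> mapped an orbit of the
  rotation \<open>\<kappa> \<circ> \<iota>\<close> to itself, then \<open>\<iota>\<close> or \<open>\<kappa>\<close> would have a fixed point half way between \<open>y\<close> and \<open>\<iota> y\<close>.
\<close>

lemma dihedral_orbit:
  fixes \<iota> \<kappa> :: "'b \<Rightarrow> 'b"
  defines "\<sigma> \<equiv> \<lambda>y. \<kappa> (\<iota> y)"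
  assumes "finite S" "x \<in> S"
    and \<iota>: "\<And>y. y \<in> S \<Longrightarrow> \<iota> y \<in> S \<and> \<iota> y \<noteq> y \<and> \<iota> (\<iota> y) = y"
    and \<kappa>: "\<And>y. y \<in> S \<Longrightarrow> \<kappa> y \<in> S \<and> \<kappa> y \<noteq> y \<and> \<kappa> (\<kappa> y) = y"
  obtains n where "n > 0" "(\<sigma> ^^ n) x = x" "inj_on (\<lambda>i. (\<sigma> ^^ i) x) {..<n}"
    "\<And>i j. (\<sigma> ^^ i) x \<noteq> \<iota> ((\<sigma> ^^ j) x)"
proof -
  have \<sigma>: "\<sigma> y \<in> S" if "y \<in> S" for y
    unfolding \<sigma>_def using \<iota> \<kappa> that by blast
  have inj: "y = z" if "\<sigma> y = \<sigma> z" "y \<in> S" "z \<in> S" for y z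
    using that \<iota> \<kappa> unfolding \<sigma>_def by metis
  have orbit: "(\<sigma> ^^ i) x \<in> S" for i
    by (induction i) (auto simp: \<sigma> \<open>x \<in> S\<close>)
  have cancel: "(\<sigma> ^^ j) x = x" if "(\<sigma> ^^ (i + j)) x = (\<sigma> ^^ i) x" for i j
    using that
  proof (induction i)
    case (Suc i)
    then have "(\<sigma> ^^ (i + j)) x = (\<sigma> ^^ i) x"
      using inj[OF _ orbit[of "i + j"] orbit[of i]] by simp
    then show ?case by (rule Suc.IH)
  qed simp
  define n where "n = (LEAST n. n > 0 \<and> (\<sigma> ^^ n) x = x)"
  have "\<not> inj (\<lambda>i. (\<sigma> ^^ i) x)"
    using orbit \<open>finite S\<close> by (metis finite_subset image_subsetI infinite_UNIV_nat finite_imageD)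
  then obtain i j where "i < j" "(\<sigma> ^^ i) x = (\<sigma> ^^ j) x"
    unfolding inj_on_def by (metis linorder_neqE_nat)
  then have "j - i > 0 \<and> (\<sigma> ^^ (j - i)) x = x"
    using cancel[of i "j - i"] by simp
  then have n: "n > 0 \<and> (\<sigma> ^^ n) x = x"
    unfolding n_def by (rule LeastI)
  have no_smaller: "\<not> (m > 0 \<and> (\<sigma> ^^ m) x = x)" if "m < n" for m
    using that not_less_Least unfolding n_def by blast
  have "i = j" if "i < n" "j < n" "(\<sigma> ^^ i) x = (\<sigma> ^^ j) x" for i j
  proof (rule ccontr)
    assume "i \<noteq> j"
    then consider "i < j" | "j < i" by linarith
    then show False
    proof cases
      case 1
      then show False
        using that cancel[of i "j - i"] no_smaller[of "j - i"] by (simp add: less_imp_diff_less)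
    next
      case 2
      then show False
        using that cancel[of j "i - j"] no_smaller[of "i - j"] by (simp add: less_imp_diff_less)
    qed
  qed
  then have inj_n: "inj_on (\<lambda>i. (\<sigma> ^^ i) x) {..<n}"
    by (auto simp: inj_on_def)
  have period: "(\<sigma> ^^ (i + j * n)) x = (\<sigma> ^^ i) x" for i j
  proof (induction j)
    case (Suc j)
    have eq: "i + Suc j * n = (i + j * n) + n" by simp
    have "(\<sigma> ^^ (i + Suc j * n)) x = (\<sigma> ^^ (i + j * n)) ((\<sigma> ^^ n) x)"
      unfolding eq by (simp only: funpow_add[of "i + j * n" n] comp_apply)
    then show ?case using Suc n by simp
  qed simp
  \<comment> \<open>Induction in steps of two: conjugation by \<sigma> turns a relation between
    \<open>y\<close> and \<open>\<iota> y\<close> with exponent \<open>k + 2\<close> into one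
    between \<open>\<sigma> y\<close> and \<open>\<iota> (\<sigma> y)\<close> with exponent
    \<open>k\<close>. The base cases 0 and 1 would be fixed points of \<iota> and of
    \<kappa>.\<close>
  have no_reflection: "y \<in> S \<Longrightarrow> (\<sigma> ^^ k) y \<noteq> \<iota> y" for k y
  proof (induction k arbitrary: y rule: induct_nat_012)
    case 0
    then show ?case using \<iota>[of y] by auto
  next
    case 1
    then show ?case using \<iota>[of y] \<kappa>[of "\<iota> y"] by (simp add: \<sigma>_def)
  next
    case (ge2 k)
    show ?case
    proof
      assume *: "(\<sigma> ^^ Suc (Suc k)) y = \<iota> y"
      have "\<sigma> (\<iota> (\<sigma> y)) = \<iota> y"
        unfolding \<sigma>_def using \<iota> \<kappa> ge2.prems by simp
      moreover have "(\<sigma> ^^ Suc (Suc k)) y = \<sigma> ((\<sigma> ^^ k) (\<sigma> y))"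
        using funpow_swap1[of \<sigma> k y] by simp
      ultimately have "\<sigma> ((\<sigma> ^^ k) (\<sigma> y)) = \<sigma> (\<iota> (\<sigma> y))"
        using * by simp
      moreover have "(\<sigma> ^^ k) (\<sigma> y) \<in> S"
        by (induction k) (simp_all add: \<sigma> ge2.prems)
      moreover have "\<iota> (\<sigma> y) \<in> S"
        using \<iota> \<sigma> ge2.prems by simp
      ultimately have "(\<sigma> ^^ k) (\<sigma> y) = \<iota> (\<sigma> y)"
        by (rule inj)
      then show False
        using ge2.IH(1)[OF \<sigma>[OF ge2.prems]] by simp
    qed
  qed
  have "\<And>i j. (\<sigma> ^^ i) x \<noteq> \<iota> ((\<sigma> ^^ j) x)"
  proof
    fix i j
    assume "(\<sigma> ^^ i) x = \<iota> ((\<sigma> ^^ j) x)"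
    \<comment> \<open>Adding \<open>j\<close> full periods makes the exponent at least
      \<open>j\<close>, so that the equation becomes one about the point
      \<open>(\<sigma> ^^ j) x\<close> and its reflection.\<close>
    then have "(\<sigma> ^^ (i + j * n)) x = \<iota> ((\<sigma> ^^ j) x)"
      using period by simp
    moreover have "j \<le> i + j * n"
      using n by (cases n) auto
    then have "(\<sigma> ^^ (i + j * n)) x = (\<sigma> ^^ (i + j * n - j)) ((\<sigma> ^^ j) x)"
      by (metis comp_apply funpow_add le_add_diff_inverse2)
    ultimately show False
      using no_reflection orbit by metis
  qed
  then show thesis
    by (rule that[OF conjunct1[OF n] conjunct2[OF n] inj_n])
qed

text \<open>The involutions act on the pairs of a face and an edge of \<open>A\<close> incident with
  it: \<iota> exchanges the two edges of the face, \<kappa> the two faces at the edge. One step of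
  the walk is \<iota> followed by \<kappa>. The dihedral lemma gives more than distinct pairs: if
  the walk met a face or an edge a second time, it would run back through it, and the orbit would
  contain a reflected pair.\<close>

lemma alternating_cycle:
  assumes "finite FF" "finite A"
    and two_edges: "\<And>F. F \<in> FF \<Longrightarrow> card {e \<in> A. inc e F} = 2"
    and two_faces: "\<And>e. e \<in> A \<Longrightarrow> card {F \<in> FF. inc e F} = 2"
    and start: "F0 \<in> FF" "e0 \<in> A" "inc e0 F0"
  obtains f e n where "n > (0::nat)" "f 0 = F0" "e 0 = e0" "e n = e 0"
    "\<And>i. f i \<in> FF" "\<And>i. e i \<in> A" "\<And>i. inc (e i) (f i)" "\<And>i. inc (e (Suc i)) (f i)"
    "\<And>i. e i \<noteq> e (Suc i)" "inj_on f {..<n}" "inj_on e {..<n}"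
    "\<And>i F. \<lbrakk>F \<in> FF; inc (e i) F\<rbrakk> \<Longrightarrow> F \<in> f ` {..<n}"
proof -
  define S where "S = {(F, e). F \<in> FF \<and> e \<in> A \<and> inc e F}"
  define \<iota> where "\<iota> = (\<lambda>(F, e). (F, other_element {e \<in> A. inc e F} e))"
  define \<kappa> where "\<kappa> = (\<lambda>(F, e). (other_element {F \<in> FF. inc e F} F, e))"
  have "S \<subseteq> FF \<times> A"
    unfolding S_def by blast
  then have "finite S"
    by (rule finite_subset) (intro finite_cartesian_product assms(1,2))
  have \<iota>: "\<iota> y \<in> S \<and> \<iota> y \<noteq> y \<and> \<iota> (\<iota> y) = y" if "y \<in> S" for y
  proof -
    obtain F e where y: "y = (F, e)" "F \<in> FF" "e \<in> {e \<in> A. inc e F}"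
      using \<open>y \<in> S\<close> unfolding S_def by blast
    then show ?thesis
      using other_element(1-3)[OF two_edges[OF y(2)] y(3)] by (simp add: S_def \<iota>_def)
  qed
  have \<kappa>: "\<kappa> y \<in> S \<and> \<kappa> y \<noteq> y \<and> \<kappa> (\<kappa> y) = y" if "y \<in> S" for y
  proof -
    obtain F e where y: "y = (F, e)" "e \<in> A" "F \<in> {F \<in> FF. inc e F}"
      using \<open>y \<in> S\<close> unfolding S_def by blast
    then show ?thesis
      using other_element(1-3)[OF two_faces[OF y(2)] y(3)] by (simp add: S_def \<kappa>_def)
  qed
  define \<sigma> where "\<sigma> = (\<lambda>y. \<kappa> (\<iota> y))"
  have "(F0, e0) \<in> S"
    using start by (simp add: S_def)
  then obtain n where n: "n > 0" "(\<sigma> ^^ n) (F0, e0) = (F0, e0)"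
    "inj_on (\<lambda>i. (\<sigma> ^^ i) (F0, e0)) {..<n}" "\<And>i j. (\<sigma> ^^ i) (F0, e0) \<noteq> \<iota> ((\<sigma> ^^ j) (F0, e0))"
    using dihedral_orbit[OF \<open>finite S\<close> _ \<iota> \<kappa>, of "(F0, e0)" thesis] unfolding \<sigma>_def by simp
  define x where "x i = (\<sigma> ^^ i) (F0, e0)" for i
  define f where "f i = fst (x i)" for i
  define e where "e i = snd (x i)" for i
  have x_Suc: "x (Suc i) = \<kappa> (\<iota> (x i))" for i
    by (simp add: x_def \<sigma>_def)
  have xS: "x i \<in> S" for i
  proof (induction i)
    case 0
    then show ?case using \<open>(F0, e0) \<in> S\<close> by (simp add: x_def)
  next
    case (Suc i)
    then show ?case unfolding x_Suc using \<iota> \<kappa> by blast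
  qed
  have x: "x i = (f i, e i)" for i
    by (simp add: f_def e_def)
  have fe: "f i \<in> FF" "e i \<in> A" "inc (e i) (f i)" for i
    using xS[of i] x[of i] by (auto simp: S_def)
  have \<iota>x: "\<iota> (x i) = (f i, e (Suc i))" for i
    using x_Suc[of i] x[of i] x[of "Suc i"] by (auto simp: \<iota>_def \<kappa>_def)
  have next_edge: "inc (e (Suc i)) (f i)" "e i \<noteq> e (Suc i)" for i
    using \<iota>[OF xS[of i]] \<iota>x[of i] x[of i] by (auto simp: S_def)
  have edges: "e' = e i \<or> e' = e (Suc i)" if "e' \<in> A" "inc e' (f i)" for e' i
  proof -
    have "e (Suc i) = other_element {e \<in> A. inc e (f i)} (e i)"
      using \<iota>x[of i] x[of i] by (simp add: \<iota>_def)
    then show ?thesis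
      using other_element(4)[OF two_edges[OF fe(1)[of i]], of "e i" e'] fe[of i] that by simp
  qed
  have faces: "F = f i \<or> F = f (Suc i)" if "F \<in> FF" "inc (e (Suc i)) F" for F i
  proof -
    have "f (Suc i) = other_element {F \<in> FF. inc (e (Suc i)) F} (f i)"
      using x_Suc[of i] \<iota>x[of i] x[of "Suc i"] by (simp add: \<kappa>_def)
    then show ?thesis
      using other_element(4)[OF two_faces[OF fe(2)[of "Suc i"]], of "f i" F] fe[of i] next_edge[of i] that
      by simp
  qed
  have x_n: "x n = x 0"
    using n by (simp add: x_def)
  have inj_x: "i = j" if "x i = x j" "i < n" "j < n" for i j
    using n(3) that unfolding x_def inj_on_def by blast
  have no_reflection: "x i \<noteq> \<iota> (x j)" for i j
    using n(4) unfolding x_def by blast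
  \<comment> \<open>Index 0 has no predecessor among the naturals; \<open>x 0 = x n\<close> supplies
    one.\<close>
  have edge_pred: "\<exists>k. e i = e (Suc k) \<and> f i = f (Suc k)" for i
    using x_n x n(1) by (cases i) (metis Pair_inject gr0_implies_Suc, blast)
  \<comment> \<open>Two different pairs with the same face are exchanged by \<iota>, which
    \<open>no_reflection\<close> forbids.\<close>
  have "i = j" if "f i = f j" "i < n" "j < n" for i j
  proof (rule ccontr)
    assume "i \<noteq> j"
    then have "e i \<noteq> e j"
      using inj_x that x by metis
    then have "e i = e (Suc j)"
      using edges[of "e i" j] fe[of i] that(1) by auto
    then show False
      using no_reflection[of i j] that(1) x[of i] \<iota>x[of j] by simp
  qed
  then have inj_f: "inj_on f {..<n}"
    by (auto simp: inj_on_def)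
  \<comment> \<open>Two different pairs with the same edge are exchanged by \<kappa>. Since
    \<open>x j\<close> is \<kappa> of the reflection of its predecessor \<open>x k\<close>, the pair
    \<open>x i\<close> is that reflection itself.\<close>
  have "i = j" if "e i = e j" "i < n" "j < n" for i j
  proof (rule ccontr)
    assume "i \<noteq> j"
    then have ne: "f i \<noteq> f j"
      using inj_x that x by metis
    obtain k where k: "e j = e (Suc k)" "f j = f (Suc k)"
      using edge_pred by blast
    then have "f i = f k"
      using faces[of "f i" k] fe[of i] that(1) ne by auto
    then show False
      using no_reflection[of i k] x[of i] \<iota>x[of k] that(1) k by simp
  qed
  then have inj_e: "inj_on e {..<n}"
    by (auto simp: inj_on_def)
  have periodic: "x (i mod n) = x i" for i
    unfolding x_def using n(2) by (metis funpow_mod_eq)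
  then have f_range: "f i \<in> f ` {..<n}" for i
    using x n(1) by (metis Pair_inject imageI lessThan_iff mod_less_divisor)
  have "F \<in> f ` {..<n}" if "F \<in> FF" "inc (e i) F" for i F
  proof -
    obtain k where "e i = e (Suc k)" using edge_pred by blast
    then have "F = f k \<or> F = f (Suc k)"
      using faces that by auto
    then show ?thesis using f_range by blast
  qed
  moreover have "f 0 = F0" "e 0 = e0" "e n = e 0"
    using x_n by (simp_all add: f_def e_def x_def)
  ultimately show thesis
    using that n(1) fe next_edge inj_f inj_e by blast
qed

section \<open>Charts of the faces of a triangulation\<close>

text \<open>In the coordinates of the disk \<open>U\<close>, a small round ball around the image of
  \<open>v\<close> works: a punctured ball in the plane is connected. This expresses that a surface
  is not pinched at a point.\<close>

lemma punctured_neighbourhood_connected: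
  assumes U: "openin M U" "v \<in> U" "subtopology M U homeomorphic_space open_disk"
    and N: "openin M N" "v \<in> N"
  obtains B where "openin M B" "v \<in> B" "B \<subseteq> N" "connectedin M (B - {v})"
proof -
  have UM: "U \<subseteq> topspace M" using U(1) by (rule openin_subset)
  obtain f g where fg: "homeomorphic_maps (subtopology M U) open_disk f g"
    using U(3) unfolding homeomorphic_space_def by blast
  then have hom: "homeomorphic_map open_disk (subtopology M U) g" and f: "f ` U = ball 0 1"
    and gf: "\<And>x. x \<in> U \<Longrightarrow> g (f x) = x" and fg': "\<And>z. z \<in> ball 0 1 \<Longrightarrow> f (g z) = z"
    using homeomorphic_imp_surjective_map[of "subtopology M U" open_disk f] UM
    by (auto simp: homeomorphic_map_maps homeomorphic_maps_def open_disk_def Int_absorb1 Int_absorb2)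
  have "openin (subtopology M U) (U \<inter> N)"
    using N(1) by (simp add: openin_subtopology_Int2)
  moreover have "homeomorphic_map (subtopology M U) open_disk f"
    using fg homeomorphic_map_maps by blast
  ultimately have "openin open_disk (f ` (U \<inter> N))"
    using homeomorphic_imp_open_map open_map_def by blast
  then have "open (f ` (U \<inter> N))"
    unfolding open_disk_def using openin_open_trans open_ball by blast
  moreover have "f v \<in> f ` (U \<inter> N)"
    using U(2) N(2) by blast
  ultimately obtain r where r: "r > 0" "ball (f v) r \<subseteq> f ` (U \<inter> N)"
    using open_contains_ball by blast
  have sub: "ball (f v) r \<subseteq> ball 0 1"
    using r(2) f by blast
  show thesis
  proof
    have "openin open_disk (ball (f v) r)"
      unfolding open_disk_def using sub by (simp add: open_subset)
    then have "openin (subtopology M U) (g ` ball (f v) r)"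
      using hom homeomorphic_imp_open_map open_map_def by blast
    then show "openin M (g ` ball (f v) r)"
      using U(1) openin_trans_full by blast
    have "g (f v) \<in> g ` ball (f v) r"
      using r(1) by simp
    then show "v \<in> g ` ball (f v) r"
      using gf[OF U(2)] by simp
    show "g ` ball (f v) r \<subseteq> N"
    proof (rule image_subsetI)
      fix z assume "z \<in> ball (f v) r"
      then obtain x where "x \<in> U \<inter> N" "z = f x" using r(2) by blast
      then show "g z \<in> N" using gf by simp
    qed
    have eq: "g ` ball (f v) r - {v} = g ` (ball (f v) r - {f v})"
    proof
      show "g ` ball (f v) r - {v} \<subseteq> g ` (ball (f v) r - {f v})"
        using gf[OF U(2)] by blast
      show "g ` (ball (f v) r - {f v}) \<subseteq> g ` ball (f v) r - {v}"
        using fg' sub by (smt (verit, best) Diff_iff image_iff insertI1 singletonD subsetD subsetI)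
    qed
    have "connectedin open_disk (ball (f v) r - {f v})"
      unfolding open_disk_def connectedin_subtopology
      using sub connected_punctured_ball[of "f v" r] by auto
    then have "connectedin (subtopology M U) (g ` (ball (f v) r - {f v}))"
      using connectedin_continuous_map_image homeomorphic_imp_continuous_map[OF hom] by blast
    then show "connectedin M (g ` ball (f v) r - {v})"
      unfolding eq connectedin_subtopology by blast
  qed
qed

text \<open>The combinatorial and topological content without zigzags: \<open>A\<close> stands for
  the edges of type I, \<open>E - A\<close> for those of type II, and \<open>FF\<close> for the
  closed faces. The open face belonging to \<open>F\<close> is written
  \<open>F - \<Union>E\<close>.\<close>

locale two_coloured_triangulation =
  fixes M :: "'a topology" and V :: "'a set" and E A FF :: "'a set set"
  assumes Hausdorff: "Hausdorff_space M"
    and locally_disk: "x \<in> topspace M \<Longrightarrow> \<exists>U. openin M U \<and> x \<in> U \<and> subtopology M U homeomorphic_space open_disk"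
    and fin: "finite V" "finite E" "finite FF"
    and topspace_eq: "topspace M = \<Union>FF"
    and arc: "e \<in> E \<Longrightarrow> edge_arc M V e"
    and edges_meet: "\<lbrakk>e \<in> E; e' \<in> E; e \<noteq> e'\<rbrakk> \<Longrightarrow> e \<inter> e' \<subseteq> V"
    and vertex_in_edge: "V \<subseteq> \<Union>E"
    and triangle: "F \<in> FF \<Longrightarrow> \<exists>h. triangle_map M h \<and> h ` std_triangle = F \<and>
      h ` interior std_triangle = F - \<Union>E \<and> {h ` bottom_side, h ` left_side, h ` slanted_side} \<subseteq> E"
    and face_closure: "F \<in> FF \<Longrightarrow> M closure_of (F - \<Union>E) = F"
    and faces_meet: "\<lbrakk>F \<in> FF; F' \<in> FF; F \<noteq> F'\<rbrakk> \<Longrightarrow> F \<inter> F' \<subseteq> \<Union>E"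
    and two_faces: "e \<in> E \<Longrightarrow> card {F \<in> FF. e \<subseteq> F} = 2"
    and A_subset: "A \<subseteq> E"
    and two_edges: "F \<in> FF \<Longrightarrow> card {e \<in> A. e \<subseteq> F} = 2"
begin

definition \<Gamma> :: "'a set" where
  "\<Gamma> = \<Union>(E - A)"

definition edge_param :: "'a set \<Rightarrow> (real \<Rightarrow> 'a) \<Rightarrow> bool" where
  "edge_param e q \<longleftrightarrow> continuous_map (top_of_set {0..1}) M q \<and> inj_on q {0..1} \<and>
     q ` {0..1} = e \<and> e \<inter> V = {q 0, q 1}"

lemma edge_param_exists:
  assumes "e \<in> E"
  shows "\<exists>q. edge_param e q"
proof -
  obtain q where q: "embedding_map (top_of_set {0..1::real}) M q" "q ` {0..1} = e" "e \<inter> V = {q 0, q 1}"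
    using arc[OF assms] unfolding edge_arc_def by blast
  have "continuous_map (top_of_set {0..1}) M q \<and> inj_on q {0..1}"
    using q(1) unfolding embedding_map_def homeomorphic_eq_everything_map
    by (simp add: continuous_map_in_subtopology)
  then show ?thesis
    using q unfolding edge_param_def by blast
qed

lemma edge_param_reverse:
  assumes "edge_param e q"
  shows "edge_param e (\<lambda>t. q (1 - t))"
proof -
  have img: "(\<lambda>t. 1 - t) ` {0..1} = {0..1::real}"
    by (rule image_eq_if_inverse[where g = "\<lambda>t. 1 - t"]) auto
  have "continuous_map (top_of_set {0..1}) M (q \<circ> (\<lambda>t::real. 1 - t))"
    by (rule continuous_map_compose[of _ "top_of_set {0..1}"])
      (use assms in \<open>auto simp: edge_param_def intro!: continuous_intros\<close>)
  moreover have "inj_on (q \<circ> (\<lambda>t::real. 1 - t)) {0..1}"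
    by (rule comp_inj_on) (use assms img in \<open>auto simp: edge_param_def inj_on_def\<close>)
  moreover have "(q \<circ> (\<lambda>t::real. 1 - t)) ` {0..1} = e"
    using assms img by (simp only: image_comp[symmetric] edge_param_def)
  ultimately show ?thesis
    using assms by (auto simp: edge_param_def o_def)
qed

lemma edge_paramD:
  assumes "edge_param e q"
  shows "continuous_map (top_of_set {0..1}) M q" "inj_on q {0..1}" "q ` {0..1} = e" "q 0 \<in> V" "q 1 \<in> V"
    "q 0 \<noteq> q 1" "t \<in> {0..1} \<Longrightarrow> q t \<in> e" "t \<in> {0<..<1} \<Longrightarrow> q t \<in> e - V"
    "x \<in> e \<Longrightarrow> x \<in> V \<Longrightarrow> x = q 0 \<or> x = q 1"
    "x \<in> e - V \<Longrightarrow> \<exists>t\<in>{0<..<1}. x = q t"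
proof -
  show q: "continuous_map (top_of_set {0..1}) M q" "inj_on q {0..1}" "q ` {0..1} = e" "q 0 \<in> V" "q 1 \<in> V"
    "x \<in> e \<Longrightarrow> x \<in> V \<Longrightarrow> x = q 0 \<or> x = q 1"
    using assms unfolding edge_param_def by blast+
  show e: "q t \<in> e" if "t \<in> {0..1}" for t
    using that q(3) by blast
  show "q 0 \<noteq> q 1"
    using inj_onD[OF q(2), of 0 1] by auto
  show "q t \<in> e - V" if "t \<in> {0<..<1}"
  proof -
    have "q t \<noteq> q 0" "q t \<noteq> q 1"
      using that inj_onD[OF q(2), of t 0] inj_onD[OF q(2), of t 1] by auto
    moreover have "e \<inter> V = {q 0, q 1}"
      using assms unfolding edge_param_def by blast
    ultimately show ?thesis
      using e[of t] that by auto
  qed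
  show "\<exists>t\<in>{0<..<1}. x = q t" if "x \<in> e - V"
  proof -
    obtain t where t: "t \<in> {0..1}" "x = q t"
      using \<open>x \<in> e - V\<close> q(3) by blast
    then have "t \<noteq> 0" "t \<noteq> 1"
      using that q(4,5) by auto
    then show ?thesis
      using t by (intro bexI[of _ t]) auto
  qed
qed

lemma closedin_edge: "e \<in> E \<Longrightarrow> closedin M e"
proof -
  assume "e \<in> E"
  then obtain q where "edge_param e q" using edge_param_exists by blast
  then have "compactin M e"
    using image_compactin[of "top_of_set {0..1::real}" "{0..1}" M q]
    by (simp add: edge_param_def compactin_subtopology)
  then show ?thesis
    using compactin_imp_closedin Hausdorff by blast
qed

lemma closedin_face: "F \<in> FF \<Longrightarrow> closedin M F"
  using face_closure closedin_closure_of by metis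

lemma infinite_edge: "e \<in> E \<Longrightarrow> infinite e"
proof -
  assume "e \<in> E"
  then obtain q where "edge_param e q"
    using edge_param_exists by blast
  then have "inj_on q {0..1}" "e = q ` {0..1}"
    by (auto simp: edge_param_def)
  then show ?thesis
    by (simp add: finite_image_iff infinite_Icc_iff)
qed

lemma openin_complement_\<Gamma>: "openin M (topspace M - \<Gamma>)"
  unfolding \<Gamma>_def using fin(2) closedin_edge by (intro openin_diff openin_topspace closedin_Union) auto

text \<open>An edge inside a face lies on its boundary. If it were none of the three sides, it would
  meet them in vertices only and so consist of vertices, but edges are infinite and \<open>V\<close>
  is finite.\<close>

lemma face_sides:
  assumes "F \<in> FF" "triangle_map M h" "h ` std_triangle = F" "h ` interior std_triangle = F - \<Union>E"
    "{h ` bottom_side, h ` left_side, h ` slanted_side} \<subseteq> E"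
  shows "{e \<in> E. e \<subseteq> F} = {h ` bottom_side, h ` left_side, h ` slanted_side}"
    "F \<inter> \<Union>E \<subseteq> \<Union>{h ` bottom_side, h ` left_side, h ` slanted_side}"
proof -
  let ?s = "{h ` bottom_side, h ` left_side, h ` slanted_side}"
  have "F = h ` interior std_triangle \<union> \<Union>?s"
    using arg_cong[OF std_triangle_eq_sides, of "image h"] assms(3) by (simp add: image_Un Un_assoc)
  then show boundary: "F \<inter> \<Union>E \<subseteq> \<Union>?s"
    using assms(4) by blast
  have in_s: "e \<in> ?s" if e: "e \<in> E" "e \<subseteq> F" for e
  proof (rule ccontr)
    assume "e \<notin> ?s"
    have "e \<subseteq> V"
    proof
      fix x assume "x \<in> e"
      then obtain s where "s \<in> ?s" "x \<in> s"
        using boundary e by (meson IntI UnionE UnionI subsetD)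
      then have "s \<in> E" "s \<noteq> e"
        using assms(5) \<open>e \<notin> ?s\<close> by auto
      then show "x \<in> V"
        using edges_meet[OF e(1), of s] \<open>x \<in> e\<close> \<open>x \<in> s\<close> by blast
    qed
    then show False
      using infinite_edge[OF e(1)] fin(1) finite_subset by blast
  qed
  have sub: "\<Union>?s \<subseteq> F"
    using \<open>F = h ` interior std_triangle \<union> \<Union>?s\<close> by blast
  have eq: "{e \<in> E. e \<subseteq> F} = S" if "\<And>e. e \<in> E \<Longrightarrow> e \<subseteq> F \<Longrightarrow> e \<in> S" "\<Union>S \<subseteq> F" "S \<subseteq> E" for S
    using that by blast
  show "{e \<in> E. e \<subseteq> F} = ?s"
    by (rule eq[OF in_s sub assms(5)])
qed

lemma A_edges_of_face:
  assumes "F \<in> FF" "e \<in> A" "e' \<in> A" "e \<subseteq> F" "e' \<subseteq> F" "e \<noteq> e'"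
  shows "{e \<in> A. e \<subseteq> F} = {e, e'}"
proof -
  have "card {e \<in> A. e \<subseteq> F} = card {e, e'}"
    using two_edges[OF assms(1)] assms(6) by simp
  moreover have "finite {e \<in> A. e \<subseteq> F}"
    using finite_subset[OF A_subset fin(2)] by simp
  ultimately show ?thesis
    using assms card_subset_eq[of "{e \<in> A. e \<subseteq> F}" "{e, e'}"] by simp
qed

lemma boundary_point_in_side:
  assumes "F \<in> FF" "x \<in> F" "x \<in> \<Union>E"
  obtains e where "e \<in> E" "e \<subseteq> F" "x \<in> e"
proof -
  obtain h where h: "triangle_map M h" "h ` std_triangle = F" "h ` interior std_triangle = F - \<Union>E"
    "{h ` bottom_side, h ` left_side, h ` slanted_side} \<subseteq> E"
    using triangle[OF assms(1)] by blast
  have "x \<in> \<Union>{h ` bottom_side, h ` left_side, h ` slanted_side}"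
    using subsetD[OF face_sides(2)[OF assms(1) h]] assms(2,3) by simp
  then obtain e where "e \<in> {h ` bottom_side, h ` left_side, h ` slanted_side}" "x \<in> e"
    by (rule UnionE)
  then show thesis
    unfolding face_sides(1)[OF assms(1) h, symmetric] using that by blast
qed

text \<open>The face as a strip from the type I edge parametrised by \<open>q\<close> to the one
  parametrised by \<open>q'\<close>. Exactly one of the horizontal sides \<open>t = 0\<close> and
  \<open>t = 1\<close> collapses to the common vertex; the other runs in \<Gamma>. Which one it is
  depends on the directions of \<open>q\<close> and \<open>q'\<close>, hence the symmetric
  formulation.\<close>

definition chart :: "'a set \<Rightarrow> (real \<Rightarrow> 'a) \<Rightarrow> (real \<Rightarrow> 'a) \<Rightarrow> (real \<times> real \<Rightarrow> 'a) \<Rightarrow> bool" where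
  "chart F q q' \<phi> \<longleftrightarrow> continuous_map (top_of_set ({0..1} \<times> {0..1})) M \<phi> \<and>
     (\<forall>t\<in>{0..1}. \<phi> (0, t) = q t \<and> \<phi> (1, t) = q' t) \<and>
     bij_betw \<phi> ({0<..<1} \<times> {0<..<1}) (F - \<Union>E) \<and>
     (q 0 = q' 0 \<longleftrightarrow> q 1 \<noteq> q' 1) \<and>
     (\<forall>s\<in>{0..1}. \<forall>t\<in>{0, 1}. if q t = q' t then \<phi> (s, t) = q t else \<phi> (s, t) \<in> \<Gamma>)"

lemma triangle_choose_edges:
  assumes F: "F \<in> FF" "e \<in> E" "e' \<in> E" "e \<subseteq> F" "e' \<subseteq> F" "e \<noteq> e'"
  obtains g where "triangle_map M g" "g ` interior std_triangle = F - \<Union>E"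
    "g ` bottom_side = e" "g ` left_side = e'" "g ` slanted_side \<in> {a \<in> E. a \<subseteq> F} - {e, e'}"
    "e \<inter> e' = {g 0}"
proof -
  obtain h where h: "triangle_map M h" "h ` std_triangle = F" "h ` interior std_triangle = F - \<Union>E"
    "{h ` bottom_side, h ` left_side, h ` slanted_side} \<subseteq> E"
    using triangle[OF F(1)] by blast
  note sides = face_sides(1)[OF F(1) h]
  have "{e, e'} \<subseteq> {h ` bottom_side, h ` left_side, h ` slanted_side}"
    unfolding sides[symmetric] using F by blast
  then obtain g where g: "triangle_map M g" "g ` std_triangle = h ` std_triangle"
    "g ` interior std_triangle = h ` interior std_triangle"
    "g ` bottom_side = e" "g ` left_side = e'"
    "g ` slanted_side \<in> {h ` bottom_side, h ` left_side, h ` slanted_side} - {e, e'}"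
    by (rule triangle_map_choose_sides[OF h(1) F(6)])
  have slanted: "g ` slanted_side \<in> {a \<in> E. a \<subseteq> F} - {e, e'}"
    unfolding sides by (rule g(6))
  have "bottom_side \<inter> left_side = {0}"
    by (auto simp: side_defs complex_eq_iff)
  then have meet: "e \<inter> e' = {g 0}"
    using inj_on_image_Int[of g std_triangle bottom_side left_side] g(1,4,5)
    by (simp add: triangle_map_def bottom_side_def left_side_def)
  have "g ` interior std_triangle = F - \<Union>E"
    using g(3) h(3) by simp
  then show thesis
    by (rule that[OF g(1) _ g(4,5) slanted meet])
qed

lemma face_edges_meet:
  assumes "F \<in> FF" "e \<in> E" "e' \<in> E" "e \<subseteq> F" "e' \<subseteq> F" "e \<noteq> e'"
  shows "\<exists>a\<in>V. e \<inter> e' = {a}"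
proof -
  obtain a where "e \<inter> e' = {a}"
    by (rule triangle_choose_edges[OF assms]) (rule that)
  then show ?thesis
    using edges_meet[OF assms(2,3,6)] by blast
qed

lemma chart_exists_0:
  assumes F: "F \<in> FF" "e \<in> A" "e' \<in> A" "e \<subseteq> F" "e' \<subseteq> F" "e \<noteq> e'"
    and q: "edge_param e q" "edge_param e' q'" "q 0 = q' 0"
  shows "\<exists>\<phi>. chart F q q' \<phi>"
proof -
  have E: "e \<in> E" "e' \<in> E"
    using F(2,3) A_subset by auto
  obtain g where g: "triangle_map M g" "g ` interior std_triangle = F - \<Union>E"
    "g ` bottom_side = e" "g ` left_side = e'" "g ` slanted_side \<in> {a \<in> E. a \<subseteq> F} - {e, e'}"
    "e \<inter> e' = {g 0}"
    by (rule triangle_choose_edges[OF F(1) E F(4-6)])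
  \<comment> \<open>The edges \<open>e\<close> and \<open>e'\<close> exhaust the two edges of
    \<open>A\<close> in \<open>F\<close>, so the third side is of the other colour.\<close>
  have slanted: "g ` slanted_side \<in> E - A"
    using g(5) unfolding A_edges_of_face[OF F, symmetric] by blast
  have "q 0 \<in> e \<inter> e'"
    using edge_paramD(7)[OF q(1), of 0] edge_paramD(7)[OF q(2), of 0] q(3) by simp
  then have q0: "q 0 = g 0" "q' 0 = g 0"
    using g(6) q(3) by auto
  have q1: "q 1 \<noteq> q' 1"
  proof
    assume "q 1 = q' 1"
    then have "q 1 \<in> e \<inter> e'"
      using edge_paramD(7)[OF q(1), of 1] edge_paramD(7)[OF q(2), of 1] by simp
    then show False
      using g(6) q0 edge_paramD(6)[OF q(1)] by simp
  qed
  obtain \<phi> where \<phi>: "continuous_map (top_of_set ({0..1::real} \<times> {0..1::real})) M \<phi>"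
    "\<And>t. t \<in> {0..1} \<Longrightarrow> \<phi> (0, t) = q t" "\<And>t. t \<in> {0..1} \<Longrightarrow> \<phi> (1, t) = q' t"
    "\<And>s. s \<in> {0..1} \<Longrightarrow> \<phi> (s, 0) = q 0" "\<And>s. s \<in> {0..1} \<Longrightarrow> \<phi> (s, 1) \<in> g ` slanted_side"
    "bij_betw \<phi> ({0<..<1} \<times> {0<..<1}) (g ` interior std_triangle)"
    by (rule triangle_sweep[OF g(1) Hausdorff, unfolded g(3,4),
        OF edge_paramD(1-3)[OF q(1)] q0(1) edge_paramD(1-3)[OF q(2)] q0(2)])
      (rule that; assumption)
  have "\<phi> (s, 1) \<in> \<Gamma>" if "s \<in> {0..1}" for s
    using \<phi>(5)[OF that] slanted unfolding \<Gamma>_def by blast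
  then have "chart F q q' \<phi>"
    unfolding chart_def using \<phi>(1-4) \<phi>(6) g(2) q(3) q1 by simp
  then show ?thesis by blast
qed

lemma chart_exists:
  assumes F: "F \<in> FF" "e \<in> A" "e' \<in> A" "e \<subseteq> F" "e' \<subseteq> F" "e \<noteq> e'"
    and q: "edge_param e q" "edge_param e' q'" "q 0 = q' 0 \<or> q 1 = q' 1"
  shows "\<exists>\<phi>. chart F q q' \<phi>"
proof (cases "q 0 = q' 0")
  case True
  then show ?thesis using chart_exists_0[OF F q(1,2)] by blast
next
  case False
  then have q1: "q 1 = q' 1" using q(3) by blast
  \<comment> \<open>Reversing both parametrisations moves the common vertex from parameter 1 to
    parameter 0; the chart obtained is then turned upside down by \<open>?r\<close>.\<close>
  then obtain \<phi> where \<phi>: "chart F (\<lambda>t. q (1 - t)) (\<lambda>t. q' (1 - t)) \<phi>"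
    using chart_exists_0[OF F edge_param_reverse[OF q(1)] edge_param_reverse[OF q(2)]] by auto
  let ?r = "\<lambda>(s::real, t::real). (s, 1 - t)"
  have "bij_betw ?r ({0<..<1} \<times> {0<..<1}) ({0<..<1} \<times> {0<..<1})"
    by (rule bij_betw_byWitness[where f' = ?r]) auto
  then have "bij_betw (\<phi> \<circ> ?r) ({0<..<1} \<times> {0<..<1}) (F - \<Union>E)"
    using \<phi> bij_betw_trans unfolding chart_def by blast
  moreover have "continuous_map (top_of_set ({0..1} \<times> {0..1})) M (\<phi> \<circ> ?r)"
  proof (rule continuous_map_compose[of _ "top_of_set ({0..1} \<times> {0..1})"])
    show "continuous_map (top_of_set ({0..1} \<times> {0..1})) (top_of_set ({0..1} \<times> {0..1})) ?r"
      unfolding case_prod_unfold by (auto intro!: continuous_intros)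
  qed (use \<phi> in \<open>simp add: chart_def\<close>)
  moreover have "\<forall>t\<in>{0..1}. (\<phi> \<circ> ?r) (0, t) = q t \<and> (\<phi> \<circ> ?r) (1, t) = q' t"
    using \<phi> by (simp add: chart_def)
  moreover have "\<forall>s\<in>{0..1}. \<forall>t\<in>{0, 1}. if q t = q' t then (\<phi> \<circ> ?r) (s, t) = q t else (\<phi> \<circ> ?r) (s, t) \<in> \<Gamma>"
    using \<phi> by (simp add: chart_def)
  ultimately have "chart F q q' (\<phi> \<circ> ?r)"
    unfolding chart_def using False q1 by blast
  then show ?thesis by blast
qed

text \<open>The two edges share a vertex, and it is an end of both. Reversing \<open>g\<close>, if
  necessary, brings this vertex to the parameter at which \<open>q\<close> takes it.\<close>

lemma orient_next_edge:
  assumes F: "F \<in> FF" "e \<in> A" "e' \<in> A" "e \<subseteq> F" "e' \<subseteq> F" "e \<noteq> e'"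
    and q: "edge_param e q" "edge_param e' g"
  obtains q' where "q' = g \<or> q' = (\<lambda>t. g (1 - t))" "q 0 = q' 0 \<or> q 1 = q' 1"
proof -
  obtain a where "a \<in> V" "e \<inter> e' = {a}"
    using face_edges_meet[OF F(1) _ _ F(4-6)] F(2,3) A_subset by blast
  then have "a = q 0 \<or> a = q 1" "a = g 0 \<or> a = g 1"
    using edge_paramD(9)[OF q(1), of a] edge_paramD(9)[OF q(2), of a] by blast+
  then show thesis
    using that[of g] that[of "\<lambda>t. g (1 - t)"] by auto
qed

end

section \<open>The band of a cycle of faces\<close>

text \<open>All sequences are indexed by the naturals, so that \<open>Suc i\<close> needs no
  reduction modulo \<open>n\<close>. After \<open>n\<close> steps the edge \<open>e 0\<close>
  returns, but its parametrisation may run backwards, as recorded in \<open>closing\<close>. By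
  \<open>faces_at_edge\<close> no face outside the cycle contains an edge of the cycle.\<close>

locale face_cycle = two_coloured_triangulation M V E A FF
  for M :: "'a topology" and V :: "'a set" and E A FF :: "'a set set" +
  fixes n :: nat and f e :: "nat \<Rightarrow> 'a set" and q :: "nat \<Rightarrow> real \<Rightarrow> 'a"
    and \<phi> :: "nat \<Rightarrow> real \<times> real \<Rightarrow> 'a"
  assumes n_pos: "n > 0"
    and cycle: "f i \<in> FF" "e i \<in> A" "e i \<subseteq> f i" "e (Suc i) \<subseteq> f i" "e i \<noteq> e (Suc i)" "e n = e 0"
    and inj_f: "inj_on f {..<n}" and inj_e: "inj_on e {..<n}"
    and faces_at_edge: "\<lbrakk>F \<in> FF; e i \<subseteq> F\<rbrakk> \<Longrightarrow> F \<in> f ` {..<n}"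
    and param: "edge_param (e i) (q i)"
    and charts: "chart (f i) (q i) (q (Suc i)) (\<phi> i)"
    and closing: "q n = q 0 \<or> q n = (\<lambda>t. q 0 (1 - t))"
begin

text \<open>The unit interval is cut into \<open>n\<close> equal parts, the \<open>i\<close>-th of
  which carries the chart of \<open>f i\<close>, rescaled to width \<open>1 / n\<close>. Where
  \<open>frac\<close> jumps from 1 to 0, the neighbouring charts agree on their common edge.\<close>

definition band :: "real \<times> real \<Rightarrow> 'a" where
  "band = (\<lambda>(x::real, t). \<phi> (nat \<lfloor>real n * x\<rfloor>) (frac (real n * x), t))"

definition open_band :: "'a set" where
  "open_band = (\<Union>i<n. f i - \<Union>E) \<union> (\<Union>i<n. e i - V)"

text \<open>Compared with \<open>open_band\<close> this contains in addition only the vertices of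
  the cycle that lie outside \<Gamma>.\<close>

definition piece :: "'a set" where
  "piece = (\<Union>i<n. f i) - \<Gamma>"

lemma chart_sides: "t \<in> {0..1} \<Longrightarrow> \<phi> i (0, t) = q i t" "t \<in> {0..1} \<Longrightarrow> \<phi> i (1, t) = q (Suc i) t"
  using charts[of i] by (simp_all add: chart_def)

lemma chart_ends:
  "s \<in> {0..1} \<Longrightarrow> t \<in> {0, 1} \<Longrightarrow> if q i t = q (Suc i) t then \<phi> i (s, t) = q i t else \<phi> i (s, t) \<in> \<Gamma>"
  using charts[of i] unfolding chart_def by blast

lemma apex: "q i 0 = q (Suc i) 0 \<longleftrightarrow> q i 1 \<noteq> q (Suc i) 1"
  using charts[of i] by (simp add: chart_def)

lemma chart_bij: "bij_betw (\<phi> i) ({0<..<1} \<times> {0<..<1}) (f i - \<Union>E)"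
  using charts[of i] by (simp add: chart_def)

lemma e_in_E: "e i \<in> E"
  using cycle(2) A_subset by blast

text \<open>The right end \<open>real n * x = i + 1\<close> is included although the floor there is
  already \<open>i + 1\<close>: the right side of chart \<open>i\<close> and the left side of chart
  \<open>i + 1\<close> are both \<open>q (Suc i)\<close>. The charts thus agree on closed slabs, as
  needed to paste them.\<close>

lemma band_eq_chart:
  assumes "real i \<le> real n * x" "real n * x \<le> real i + 1" "t \<in> {0..1}"
  shows "band (x, t) = \<phi> i (real n * x - i, t)"
proof (cases "real n * x < real i + 1")
  case True
  then have "\<lfloor>real n * x\<rfloor> = int i"
    using assms(1) by (simp add: floor_eq_iff)
  then show ?thesis
    by (simp add: band_def frac_def)
next
  case False
  then have x: "real n * x = real (Suc i)"
    using assms(2) by simp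
  then show ?thesis
    using chart_sides[of t] assms(3) by (simp add: band_def nat_add_distrib frac_def)
qed

lemma unit_interval_cases:
  assumes "x \<in> {0..1}"
  obtains i where "i < n" "real i \<le> real n * x" "real n * x \<le> real i + 1"
proof (cases "x = 1")
  case True
  then show thesis
    using that[of "n - 1"] n_pos by (simp add: of_nat_diff)
next
  case False
  define i where "i = nat \<lfloor>real n * x\<rfloor>"
  have i: "real i \<le> real n * x" "real n * x < real i + 1"
    using assms by (auto simp: i_def of_nat_nat)
  have "real n * x < real n"
    using assms False n_pos by simp
  then have "i < n"
    using i(1) by linarith
  then show thesis
    using that i by simp
qed

lemma continuous_band: "continuous_map (top_of_set ({0..1} \<times> {0..1})) M band"
proof -
  let ?Q = "{0..1::real} \<times> {0..1::real}"
  let ?T = "\<lambda>i. {p \<in> ?Q. real i \<le> real n * fst p \<and> real n * fst p \<le> real i + 1}"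
  let ?g = "\<lambda>i (p::real \<times> real). (real n * fst p - real i, snd p)"
  show ?thesis
  proof (rule pasting_lemma_closed[where I = "{..<n}" and T = ?T and f = "\<lambda>i. \<phi> i \<circ> ?g i"])
    show "closedin (top_of_set ?Q) (?T i)" for i
    proof -
      have "closed (?Q \<inter> ({p. real i \<le> real n * fst p} \<inter> {p. real n * fst p \<le> real i + 1}))"
        by (intro closed_Int closed_Times closed_Collect_le continuous_intros)
      moreover have "?Q \<inter> ({p. real i \<le> real n * fst p} \<inter> {p. real n * fst p \<le> real i + 1}) = ?T i"
        by auto
      ultimately show ?thesis
        by (metis (no_types, lifting) Collect_subset closed_subset mem_Collect_eq subsetI)
    qed
    show "continuous_map (subtopology (top_of_set ?Q) (?T i)) M (\<phi> i \<circ> ?g i)" for i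
    proof (rule continuous_map_compose[of _ "top_of_set ?Q"])
      show "continuous_map (top_of_set ?Q) M (\<phi> i)"
        using charts[of i] by (simp add: chart_def)
      have "continuous_on (?T i) (?g i)"
        by (intro continuous_intros)
      then show "continuous_map (subtopology (top_of_set ?Q) (?T i)) (top_of_set ?Q) (?g i)"
        by (auto simp: subtopology_subtopology Int_absorb1)
    qed
    have band: "(\<phi> i \<circ> ?g i) p = band p" if "p \<in> ?T i" for i p
      using band_eq_chart[of i "fst p" "snd p"] that by auto
    show "(\<phi> i \<circ> ?g i) p = (\<phi> j \<circ> ?g j) p" if "p \<in> topspace (top_of_set ?Q) \<inter> ?T i \<inter> ?T j" for i j p
      using band[of p i] band[of p j] that by simp
    show "\<exists>j. j \<in> {..<n} \<and> p \<in> ?T j \<and> band p = (\<phi> j \<circ> ?g j) p" if "p \<in> topspace (top_of_set ?Q)" for p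
    proof -
      have p: "p \<in> ?Q" using that by simp
      then have "fst p \<in> {0..1}" by auto
      then obtain i where i: "i < n" "real i \<le> real n * fst p" "real n * fst p \<le> real i + 1"
        by (rule unit_interval_cases)
      then have "p \<in> ?T i" using p by simp
      then show ?thesis
        using i(1) band[of p i] by (intro exI[of _ i]) simp
    qed
  qed simp
qed

lemma chart_half_open:
  assumes "s \<in> {0..<1}" "t \<in> {0<..<1}"
  shows "if s = 0 then \<phi> i (s, t) \<in> e i - V \<and> \<phi> i (s, t) = q i t else \<phi> i (s, t) \<in> f i - \<Union>E"
proof (cases "s = 0")
  case True
  then show ?thesis
    using chart_sides(1)[of t i] edge_paramD(8)[OF param[of i], of t] assms(2) by simp
next
  case False
  then have "(s, t) \<in> {0<..<1} \<times> {0<..<1}"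
    using assms by simp
  then show ?thesis
    using bij_betwE[OF chart_bij[of i]] False by simp
qed

lemma half_open_cases:
  assumes "x \<in> {0..<1}" "t \<in> {0..1}"
  obtains i s where "i < n" "s \<in> {0..<1}" "real n * x = real i + s" "band (x, t) = \<phi> i (s, t)"
proof -
  define i where "i = nat \<lfloor>real n * x\<rfloor>"
  have i: "real i \<le> real n * x" "real n * x < real i + 1"
    using assms by (auto simp: i_def of_nat_nat)
  have "real n * x < real n"
    using assms n_pos by simp
  then have "i < n"
    using i(1) by linarith
  then show thesis
    using that[of i "real n * x - real i"] band_eq_chart[of i x t] i assms(2) by simp
qed

text \<open>The half-open rectangle splits into the left sides \<open>s = 0\<close> and the
  interiors of the \<open>n\<close> charts. Their images are the edges without ends and the open
  faces of the cycle, which are pairwise disjoint since no face and no edge is repeated, and the map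
  is injective on each part.\<close>

lemma inj_on_band: "inj_on band ({0..<1} \<times> {0<..<1})"
proof (rule inj_onI)
  fix p p' assume p: "p \<in> {0..<1} \<times> {0<..<1}" "p' \<in> {0..<1} \<times> {0<..<1}" and eq: "band p = band p'"
  obtain x t x' t' where xt: "p = (x, t)" "p' = (x', t')"
    "x \<in> {0..<1}" "t \<in> {0<..<1}" "x' \<in> {0..<1}" "t' \<in> {0<..<1}"
    using p by auto
  then have "t \<in> {0..1}" "t' \<in> {0..1}" by auto
  obtain i s where i: "i < n" "s \<in> {0..<1}" "real n * x = real i + s" "band (x, t) = \<phi> i (s, t)"
    using half_open_cases[OF xt(3) \<open>t \<in> {0..1}\<close>] .
  obtain j s' where j: "j < n" "s' \<in> {0..<1}" "real n * x' = real j + s'" "band (x', t') = \<phi> j (s', t')"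
    using half_open_cases[OF xt(5) \<open>t' \<in> {0..1}\<close>] .
  note ci = chart_half_open[OF i(2) xt(4), of i] and cj = chart_half_open[OF j(2) xt(6), of j]
  have y: "\<phi> i (s, t) = \<phi> j (s', t')"
    using eq xt(1,2) i(4) j(4) by simp
  have "i = j \<and> s = s' \<and> t = t'"
  proof (cases "s = 0")
    case True
    then have "\<phi> i (s, t) \<in> e i - V" "\<phi> i (s, t) = q i t" using ci by auto
    moreover from this have "s' = 0"
      using cj y e_in_E[of i] by (auto split: if_splits)
    ultimately have "\<phi> i (s, t) \<in> e i - V" "\<phi> i (s, t) \<in> e j - V" "q i t = q j t'"
      using cj y by auto
    moreover from this have "e i = e j"
      using edges_meet[OF e_in_E e_in_E, of i j] by blast
    then have "i = j"
      using inj_onD[OF inj_e] i(1) j(1) by simp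
    moreover from calculation have "t = t'"
      using inj_onD[OF edge_paramD(2)[OF param[of i]], of t t'] \<open>t \<in> {0..1}\<close> \<open>t' \<in> {0..1}\<close> by simp
    ultimately show ?thesis using True \<open>s' = 0\<close> by simp
  next
    case False
    then have fi: "\<phi> i (s, t) \<in> f i - \<Union>E" using ci by auto
    have "s' \<noteq> 0"
      using cj y fi e_in_E[of j] by (auto split: if_splits)
    then have fj: "\<phi> i (s, t) \<in> f j - \<Union>E" using cj y by auto
    have "f i = f j"
      using faces_meet[OF cycle(1) cycle(1), of i j] fi fj by blast
    then have "i = j"
      using inj_onD[OF inj_f] i(1) j(1) by simp
    moreover from this have "(s, t) = (s', t')"
      using bij_betw_imp_inj_on[OF chart_bij[of i]] y i(2) j(2) xt(4,6) False \<open>s' \<noteq> 0\<close>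
      by (intro inj_onD[of "\<phi> i" "{0<..<1} \<times> {0<..<1}"]) auto
    ultimately show ?thesis by simp
  qed
  then have "real n * x = real n * x'"
    using i(3) j(3) by simp
  then show "p = p'"
    using \<open>i = j \<and> s = s' \<and> t = t'\<close> xt n_pos by simp
qed

lemma band_1: "t \<in> {0..1} \<Longrightarrow> band (1, t) = q n t"
  using chart_sides(1)[of t n] by (simp add: band_def frac_def)

lemma band_0: "t \<in> {0..1} \<Longrightarrow> band (0, t) = q 0 t"
  using chart_sides(1)[of t 0] by (simp add: band_def)

lemma band_image_half_open: "band ` ({0..<1} \<times> {0<..<1}) = open_band"
proof
  show "band ` ({0..<1} \<times> {0<..<1}) \<subseteq> open_band"
  proof clarify
    fix x t :: real assume xt: "x \<in> {0..<1}" "t \<in> {0<..<1}"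
    then have "t \<in> {0..1}" by auto
    obtain i s where i: "i < n" "s \<in> {0..<1}" "band (x, t) = \<phi> i (s, t)"
      using half_open_cases[OF xt(1) \<open>t \<in> {0..1}\<close>] .
    then show "band (x, t) \<in> open_band"
      using chart_half_open[OF i(2) xt(2), of i] unfolding open_band_def by (auto split: if_splits)
  qed
  show "open_band \<subseteq> band ` ({0..<1} \<times> {0<..<1})"
  proof
    fix y assume "y \<in> open_band"
    then obtain i where "i < n" "y \<in> f i - \<Union>E \<or> y \<in> e i - V"
      unfolding open_band_def by blast
    moreover have "\<exists>s\<in>{0..<1}. \<exists>t\<in>{0<..<1}. y = \<phi> i (s, t)"
    proof (cases "y \<in> f i - \<Union>E")
      case True
      then obtain p where "p \<in> {0<..<1} \<times> {0<..<1}" "y = \<phi> i p"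
        using bij_betw_imp_surj_on[OF chart_bij[of i]] by blast
      then show ?thesis
        by (intro bexI[of _ "fst p"] bexI[of _ "snd p"]) auto
    next
      case False
      then obtain t where t: "t \<in> {0<..<1}" "y = q i t"
        using calculation edge_paramD(10)[OF param[of i]] by blast
      then show ?thesis
        using chart_sides(1)[of t i] by (intro bexI[of _ 0] bexI[of _ t]) auto
    qed
    ultimately obtain s t where st: "i < n" "s \<in> {0..<1}" "t \<in> {0<..<1}" "y = \<phi> i (s, t)"
      by blast
    have "real i + s < real n"
      using st(1,2) by simp
    then have "(real i + s) / real n \<in> {0..<1}"
      using st n_pos by simp
    moreover have "band ((real i + s) / real n, t) = y"
      using band_eq_chart[of i "(real i + s) / real n" t] st n_pos by simp
    ultimately show "y \<in> band ` ({0..<1} \<times> {0<..<1})"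
      using st(3) by (metis SigmaI imageI)
  qed
qed

text \<open>The function \<rho> is the gluing of the right end of the rectangle to the left end.
  Keeping it abstract lets the direct and the reflected case share the computation of the
  fibres.\<close>

lemma closing_cases:
  "\<exists>\<rho>. (\<rho> = (\<lambda>t::real. t) \<or> \<rho> = (\<lambda>t. 1 - t)) \<and> (\<forall>t\<in>{0..1}. band (1, t) = band (0, \<rho> t))"
proof (cases "q n = q 0")
  case True
  then show ?thesis
    using band_0 band_1 by (intro exI[of _ "\<lambda>t. t"]) simp
next
  case False
  then show ?thesis
    using closing band_0 band_1 by (intro exI[of _ "\<lambda>t. 1 - t"]) simp
qed

lemma band_image_strip: "band ` strip = open_band"
proof -
  obtain \<rho> where \<rho>: "\<rho> = (\<lambda>t::real. t) \<or> \<rho> = (\<lambda>t. 1 - t)" "\<And>t. t \<in> {0..1} \<Longrightarrow> band (1, t) = band (0, \<rho> t)"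
    using closing_cases by blast
  have "band (1, t) \<in> open_band" if "t \<in> {0<..<1}" for t
    unfolding band_image_half_open[symmetric]
    using \<rho> that by (intro image_eqI[of _ _ "(0, \<rho> t)"]) auto
  then have right_end: "band ` ({1} \<times> {0<..<1}) \<subseteq> open_band"
    by blast
  have strip: "strip = {0..<1} \<times> {0<..<1} \<union> {1} \<times> {0<..<1}"
    by (auto simp: strip_def)
  show ?thesis
    unfolding strip image_Un band_image_half_open by (rule Un_absorb2[OF right_end])
qed

lemma A_edge_in_cycle:
  assumes "i < n" "a \<in> A" "a \<subseteq> f i"
  shows "a \<in> e ` {..<n}" "a = e i \<or> a = e (Suc i)"
proof -
  show a: "a = e i \<or> a = e (Suc i)"
    using A_edges_of_face[OF cycle(1,2) cycle(2)[of "Suc i"] cycle(3,4,5)] assms by blast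
  have "e (Suc i) \<in> e ` {..<n}"
    using assms(1) n_pos cycle(6) by (cases "Suc i = n") auto
  then show "a \<in> e ` {..<n}"
    using a assms(1) by blast
qed

lemma open_band_disjoint_V: "open_band \<inter> V = {}"
  unfolding open_band_def using vertex_in_edge by blast

lemma open_band_disjoint_other_edges: "a \<in> E \<Longrightarrow> a \<notin> e ` {..<n} \<Longrightarrow> open_band \<inter> a = {}"
  using edges_meet[OF e_in_E, of a] unfolding open_band_def by blast

lemma open_band_disjoint_\<Gamma>: "open_band \<inter> \<Gamma> = {}"
proof -
  have "open_band \<inter> a = {}" if "a \<in> E - A" for a
    by (rule open_band_disjoint_other_edges) (use that cycle(2) in auto)
  then show ?thesis
    unfolding \<Gamma>_def by blast
qed

lemma open_band_subset_piece: "open_band \<subseteq> piece"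
  using open_band_disjoint_\<Gamma> cycle(3) unfolding open_band_def piece_def by blast

lemma piece_cases:
  assumes "x \<in> piece" "x \<notin> open_band"
  obtains i where "i < n" "x \<in> V" "x \<in> e i"
proof -
  obtain i where i: "i < n" "x \<in> f i" "x \<notin> \<Gamma>"
    using assms(1) unfolding piece_def by blast
  then have "x \<in> \<Union>E"
    using assms(2) unfolding open_band_def by blast
  then obtain a where a: "a \<in> E" "a \<subseteq> f i" "x \<in> a"
    using boundary_point_in_side[OF cycle(1) i(2)] by blast
  then have "a \<in> A"
    using i(3) unfolding \<Gamma>_def by blast
  then obtain j where j: "j < n" "a = e j"
    using A_edge_in_cycle(1)[OF i(1) _ a(2)] by blast
  then have "x \<in> V"
    using assms(2) a(3) unfolding open_band_def by blast
  then show thesis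
    using that j a(3) by blast
qed

section \<open>Position of the band and of its piece in the surface\<close>

lemma piece_subset: "piece \<subseteq> topspace M - \<Gamma>"
  using cycle(1) unfolding piece_def topspace_eq by blast

text \<open>The complement is a finite union of closed sets: the faces outside the cycle, the edges
  outside the cycle, and the vertices.\<close>

lemma openin_open_band: "openin M open_band"
proof -
  have eq: "topspace M - open_band = \<Union>(FF - f ` {..<n}) \<union> \<Union>(E - e ` {..<n}) \<union> (V \<inter> topspace M)"
  proof
    show "topspace M - open_band \<subseteq> \<Union>(FF - f ` {..<n}) \<union> \<Union>(E - e ` {..<n}) \<union> (V \<inter> topspace M)"
    proof
      fix x assume x: "x \<in> topspace M - open_band"
      then obtain F where F: "F \<in> FF" "x \<in> F"
        unfolding topspace_eq by blast
      show "x \<in> \<Union>(FF - f ` {..<n}) \<union> \<Union>(E - e ` {..<n}) \<union> (V \<inter> topspace M)"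
      proof (cases "F \<in> f ` {..<n}")
        case True
        then have "x \<in> \<Union>E"
          using x F unfolding open_band_def by blast
        then obtain a where a: "a \<in> E" "x \<in> a" by blast
        show ?thesis
        proof (cases "a \<in> e ` {..<n}")
          case True
          then obtain j where "j < n" "a = e j" by blast
          then have "x \<in> V"
            using x a(2) unfolding open_band_def by blast
          then show ?thesis using x by blast
        qed (use a in blast)
      qed (use F in blast)
    qed
    \<comment> \<open>A face outside the cycle could meet the band only in an inner point of some
      \<open>e i\<close>. The side of \<open>F\<close> through this point is then \<open>e i\<close>
      itself, and a face containing \<open>e i\<close> belongs to the cycle.\<close>
    have "open_band \<inter> F = {}" if F: "F \<in> FF" "F \<notin> f ` {..<n}" for F
    proof (rule ccontr)
      assume "open_band \<inter> F \<noteq> {}"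
      then obtain x where x: "x \<in> open_band" "x \<in> F" by blast
      then obtain i where i: "i < n" "x \<in> f i - \<Union>E \<or> x \<in> e i - V"
        unfolding open_band_def by blast
      have "x \<notin> f i - \<Union>E"
        using faces_meet[OF F(1) cycle(1), of i] F(2) i(1) x(2) by blast
      then have xe: "x \<in> e i - V" using i(2) by blast
      then have "x \<in> \<Union>E" using e_in_E by blast
      then obtain a where a: "a \<in> E" "a \<subseteq> F" "x \<in> a"
        using boundary_point_in_side[OF F(1) x(2)] by blast
      then have "a = e i"
        using edges_meet[OF a(1) e_in_E, of i] xe by blast
      then show False
        using faces_at_edge[OF F(1)] a(2) F(2) by blast
    qed
    moreover have "\<Union>FF = topspace M" "\<Union>E \<subseteq> topspace M"
      using topspace_eq closedin_edge closedin_subset by blast+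
    ultimately show "\<Union>(FF - f ` {..<n}) \<union> \<Union>(E - e ` {..<n}) \<union> (V \<inter> topspace M) \<subseteq> topspace M - open_band"
      using open_band_disjoint_V open_band_disjoint_other_edges by blast
  qed
  have "closedin M (V \<inter> topspace M)"
    using fin(1) Hausdorff by (simp add: closedin_Hausdorff_finite)
  then have "closedin M (topspace M - open_band)"
    unfolding eq using fin closedin_edge closedin_face by (intro closedin_Un closedin_Union) auto
  moreover have "open_band \<subseteq> topspace M"
    using open_band_subset_piece piece_subset by blast
  ultimately show ?thesis
    by (simp add: openin_closedin)
qed

text \<open>The band is the image of a convex set, and a face is the closure of its open face. Hence
  \<open>piece\<close> lies between the connected set \<open>open_band\<close> and its
  closure.\<close>

lemma connectedin_piece: "connectedin M piece"
proof (rule connectedin_intermediate_closure_of[OF _ open_band_subset_piece])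
  have "convex strip"
    unfolding strip_def by (intro convex_Times) auto
  then have "connectedin (top_of_set ({0..1} \<times> {0..1})) strip"
    using strip_subset by (simp add: connectedin_subtopology convex_connected)
  then show "connectedin M open_band"
    using connectedin_continuous_map_image[OF continuous_band] band_image_strip by metis
  have "f i \<subseteq> M closure_of open_band" if "i < n" for i
  proof -
    have "f i - \<Union>E \<subseteq> open_band"
      using that unfolding open_band_def by blast
    then show ?thesis
      using face_closure[OF cycle(1)] closure_of_mono by metis
  qed
  then show "piece \<subseteq> M closure_of open_band"
    unfolding piece_def by blast
qed

lemma closedin_piece: "closedin (subtopology M (topspace M - \<Gamma>)) piece"
proof -
  have "closedin M (\<Union>i<n. f i)"
    using closedin_face[OF cycle(1)] by (intro closedin_Union) auto
  moreover have "piece = (\<Union>i<n. f i) \<inter> (topspace M - \<Gamma>)"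
    using piece_subset unfolding piece_def by blast
  ultimately show ?thesis
    unfolding closedin_subtopology by blast
qed

lemma piece_subset_component:
  assumes C: "C \<in> connected_components_of (subtopology M (topspace M - \<Gamma>))" and "piece \<inter> C \<noteq> {}"
  shows "piece \<subseteq> C"
proof -
  have "connectedin (subtopology M (topspace M - \<Gamma>)) piece"
    using connectedin_piece piece_subset by (simp add: connectedin_subtopology)
  then show ?thesis
    using connected_components_of_maximal[OF C] assms(2) by (simp add: disjnt_def Int_commute)
qed

text \<open>A connected set that is open and closed in the complement of \<Gamma> is a component.
  Connectedness and closedness always hold; openness is a hypothesis because it has a different
  reason with and without a type I vertex.\<close>

lemma piece_eq_component:
  assumes C: "C \<in> connected_components_of (subtopology M (topspace M - \<Gamma>))"
    and "openin M piece" "piece \<inter> C \<noteq> {}"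
  shows "C = piece"
proof
  have "openin (subtopology M (topspace M - \<Gamma>)) piece"
    using assms(2) piece_subset by (metis inf.absorb1 openin_subtopology_Int)
  then show "C \<subseteq> piece"
    using connectedin_clopen_cases[OF connectedin_connected_components_of[OF C] closedin_piece] assms(3)
    by (auto simp: disjnt_def)
  show "piece \<subseteq> C"
    by (rule piece_subset_component[OF C assms(3)])
qed

lemma band_end:
  assumes "x \<in> {0..1}" "t \<in> {0, 1}"
  obtains i where "i < n" "band (x, t) = q i t \<or> band (x, t) \<in> \<Gamma>" "q i t = q (Suc i) t \<Longrightarrow> band (x, t) = q i t"
    "q i t \<noteq> q (Suc i) t \<Longrightarrow> band (x, t) \<in> \<Gamma>"
proof -
  obtain i where i: "i < n" "real i \<le> real n * x" "real n * x \<le> real i + 1"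
    using unit_interval_cases[OF assms(1)] .
  have "band (x, t) = \<phi> i (real n * x - i, t)"
    using band_eq_chart[OF i(2,3)] assms(2) by auto
  then show thesis
    using that[OF i(1)] chart_ends[of "real n * x - i" t i] i(2,3) assms(2) by (auto split: if_splits)
qed

text \<open>This makes \<open>strip\<close> the full preimage of \<open>open_band\<close> in the
  closed rectangle, as required for \<open>band\<close> to restrict to a quotient map.\<close>

lemma band_end_not_open_band: "x \<in> {0..1} \<Longrightarrow> t \<in> {0, 1} \<Longrightarrow> band (x, t) \<notin> open_band"
  using band_end[of x t] open_band_disjoint_\<Gamma> open_band_disjoint_V edge_paramD(4,5)[OF param]
  by (metis disjoint_iff empty_iff insert_iff)

lemma band_eq_iff:
  assumes "p \<in> strip" "p' \<in> strip"
    and \<rho>: "\<And>t. t \<in> {0..1} \<Longrightarrow> band (1, t) = band (0, \<rho> t)" "\<And>t. t \<in> {0<..<1} \<Longrightarrow> \<rho> t \<in> {0<..<1}"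
      "\<And>t. \<rho> (\<rho> t) = t"
  shows "band p = band p' \<longleftrightarrow> p = p' \<or> {fst p, fst p'} = {0, 1} \<and> snd p' = \<rho> (snd p)"
proof -
  \<comment> \<open>Points of the right end are moved to the point of the left end with which they
    are glued; on the remaining half-open rectangle \<open>band\<close> is injective.\<close>
  define norm where "norm = (\<lambda>(x::real, t). if x = 1 then (0, \<rho> t) else (x, t))"
  have norm: "norm r \<in> {0..<1} \<times> {0<..<1}" "band r = band (norm r)" if "r \<in> strip" for r
    using that \<rho>(1)[of "snd r"] \<rho>(2)[of "snd r"] by (cases r; auto simp: norm_def strip_def)+
  have "band p = band p' \<longleftrightarrow> norm p = norm p'"
    using norm[OF assms(1)] norm[OF assms(2)] inj_on_eq_iff[OF inj_on_band] by simp
  also have "\<dots> \<longleftrightarrow> p = p' \<or> {fst p, fst p'} = {0, 1} \<and> snd p' = \<rho> (snd p)"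
    unfolding norm_def using \<rho>(3) by (cases p; cases p'; simp add: doubleton_eq_iff; metis)
  finally show ?thesis .
qed

lemma open_band_homeomorphic:
  "subtopology M open_band homeomorphic_space open_cylinder \<or>
   subtopology M open_band homeomorphic_space open_moebius_strip"
proof -
  have quo: "quotient_map (top_of_set strip) (subtopology M open_band) band"
    unfolding band_image_strip[symmetric]
  proof (rule quotient_map_restrict_compact[OF _ continuous_band Hausdorff strip_subset])
    show "compact ({0..1::real} \<times> {0..1::real})"
      by (intro compact_Times) auto
    show "p \<in> strip" if "p \<in> {0..1} \<times> {0..1}" "band p \<in> band ` strip" for p
    proof -
      have "snd p \<notin> {0, 1}"
        using band_end_not_open_band[of "fst p" "snd p"] that unfolding band_image_strip by auto
      then show ?thesis
        using that(1) by (auto simp: strip_def)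
    qed
  qed
  obtain \<rho> where \<rho>: "\<rho> = (\<lambda>t::real. t) \<or> \<rho> = (\<lambda>t. 1 - t)"
    and band_\<rho>: "\<And>t. t \<in> {0..1} \<Longrightarrow> band (1, t) = band (0, \<rho> t)"
    using closing_cases by blast
  have "t \<in> {0<..<1} \<Longrightarrow> \<rho> t \<in> {0<..<1}" "\<rho> (\<rho> t) = t" for t
    using \<rho> by auto
  then have fibres: "band p = band p' \<longleftrightarrow> p = p' \<or> {fst p, fst p'} = {0, 1} \<and> snd p' = \<rho> (snd p)"
    if "p \<in> strip" "p' \<in> strip" for p p'
    using band_eq_iff[OF that band_\<rho>] by blast
  show ?thesis
    using \<rho>
  proof
    assume "\<rho> = (\<lambda>t. t)"
    then have "subtopology M open_band homeomorphic_space open_cylinder"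
      using fibres by (intro homeomorphic_open_cylinder[OF quo]) auto
    then show ?thesis ..
  next
    assume "\<rho> = (\<lambda>t. 1 - t)"
    then have "subtopology M open_band homeomorphic_space open_moebius_strip"
      using fibres by (intro homeomorphic_open_moebius_strip[OF quo]) auto
    then show ?thesis ..
  qed
qed

text \<open>The piece lies in \<open>C\<close> and thus contains no vertex, so it coincides with
  \<open>open_band\<close>, which is open.\<close>

lemma component_without_vertex:
  assumes C: "C \<in> connected_components_of (subtopology M (topspace M - \<Gamma>))"
    and "piece \<inter> C \<noteq> {}" "V \<inter> C = {}"
  shows "subtopology M C homeomorphic_space open_cylinder \<or>
    subtopology M C homeomorphic_space open_moebius_strip"
proof -
  have "piece = open_band"
    using open_band_subset_piece piece_cases piece_subset_component[OF assms(1,2)] assms(3) by blast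
  then have "C = open_band"
    using piece_eq_component[OF C] openin_open_band assms(2) by simp
  then show ?thesis
    using open_band_homeomorphic by simp
qed

section \<open>Cycles of faces around a vertex outside \<Gamma>\<close>

context
  fixes v assumes v: "v \<notin> \<Gamma>" "q 0 0 = v"
begin

text \<open>The side \<open>t = 0\<close> of a chart either collapses to a vertex or lies in
  \<Gamma>. Once it starts at \<open>v\<close> outside \<Gamma>, only the former is possible, so the
  next edge starts at \<open>v\<close> as well.\<close>

lemma apex_constant: "q i 0 = v"
proof (induction i)
  case (Suc i)
  show ?case
  proof (rule ccontr)
    assume "q (Suc i) 0 \<noteq> v"
    then have "\<phi> i (0, 0) \<in> \<Gamma>"
      using chart_ends[of 0 0 i] Suc by simp
    then show False
      using chart_sides(1)[of 0 i] Suc v(1) by simp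
  qed
qed (rule v(2))

text \<open>Exactly one horizontal side of each chart collapses; it is \<open>t = 0\<close>, so the
  side \<open>t = 1\<close> runs along the type II edge.\<close>

lemma far_end_in_\<Gamma>: "q i 1 \<in> \<Gamma>"
proof -
  have "q i 1 \<noteq> q (Suc i) 1"
    using apex[of i] apex_constant by simp
  then have "\<phi> i (0, 1) \<in> \<Gamma>"
    using chart_ends[of 0 1 i] by simp
  then show ?thesis
    using chart_sides(1)[of 1 i] by simp
qed

lemma v_in_V: "v \<in> V"
  using edge_paramD(4)[OF param[of 0]] v(2) by simp

lemma v_in_piece: "v \<in> piece"
  using edge_paramD(7)[OF param[of 0], of 0] v cycle(3)[of 0] n_pos unfolding piece_def by auto

lemma piece_eq_insert: "piece = insert v open_band"
proof
  show "insert v open_band \<subseteq> piece"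
    using v_in_piece open_band_subset_piece by blast
  show "piece \<subseteq> insert v open_band"
  proof
    fix x assume x: "x \<in> piece"
    show "x \<in> insert v open_band"
    proof (cases "x \<in> open_band")
      case False
      then obtain i where i: "x \<in> V" "x \<in> e i"
        using piece_cases[OF x] by blast
      have "x \<noteq> q i 1"
        using far_end_in_\<Gamma>[of i] x unfolding piece_def by auto
      then show ?thesis
        using edge_paramD(9)[OF param i(2,1)] apex_constant by simp
    qed simp
  qed
qed

text \<open>
  Near \<open>v\<close> the surface stays connected when \<open>v\<close> is removed, so the cycle of faces fills a whole
  neighbourhood of \<open>v\<close>.
\<close>

lemma openin_piece: "openin M piece"
proof -
  have "v \<in> topspace M - \<Gamma>"
    using v_in_piece piece_subset by blast
  then obtain U where U: "openin M U" "v \<in> U" "subtopology M U homeomorphic_space open_disk"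
    using locally_disk by blast
  obtain B where B: "openin M B" "v \<in> B" "B \<subseteq> topspace M - \<Gamma>" "connectedin M (B - {v})"
    using punctured_neighbourhood_connected[OF U openin_complement_\<Gamma> \<open>v \<in> topspace M - \<Gamma>\<close>] .
  let ?X = "subtopology M (topspace M - \<Gamma> - {v})"
  have open_band: "open_band = (\<Union>i<n. f i) \<inter> (topspace M - \<Gamma> - {v})"
  proof -
    have "v \<notin> open_band"
      using open_band_disjoint_V v_in_V by blast
    then have "open_band = piece - {v}"
      using piece_eq_insert by blast
    then show ?thesis
      using piece_subset unfolding piece_def by blast
  qed
  have "closedin M (\<Union>i<n. f i)"
    using closedin_face[OF cycle(1)] by (intro closedin_Union) auto
  then have "closedin ?X open_band"
    unfolding closedin_subtopology using open_band by blast
  moreover have "openin ?X open_band"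
    unfolding openin_subtopology using openin_open_band open_band by blast
  moreover have "connectedin ?X (B - {v})"
    using B(3,4) by (auto simp: connectedin_subtopology)
  ultimately have "B - {v} \<subseteq> open_band \<or> disjnt (B - {v}) open_band"
    using connectedin_clopen_cases by blast
  \<comment> \<open>This rules out the disjoint alternative: \<open>v\<close> lies in
    \<open>f 0\<close>, the closure of an open face of the band, so each neighbourhood of
    \<open>v\<close> meets the band.\<close>
  moreover have "open_band \<inter> B \<noteq> {}"
  proof -
    have "f 0 - \<Union>E \<subseteq> open_band"
      using n_pos unfolding open_band_def by blast
    then have "f 0 \<subseteq> M closure_of open_band"
      using face_closure[OF cycle(1)] closure_of_mono by metis
    moreover have "v \<in> f 0"
      using edge_paramD(7)[OF param[of 0], of 0] v(2) cycle(3)[of 0] by auto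
    ultimately have "v \<in> M closure_of open_band" by blast
    then obtain y where "y \<in> open_band" "y \<in> B"
      unfolding in_closure_of using B(1,2) by metis
    then show ?thesis by blast
  qed
  moreover have "v \<notin> open_band"
    using open_band_disjoint_V v_in_V by blast
  ultimately have "B - {v} \<subseteq> open_band"
    by (auto simp: disjnt_def)
  then have "piece = open_band \<union> B"
    using piece_eq_insert B(2) by auto
  then show ?thesis
    using openin_open_band B(1) by (simp add: openin_Un)
qed

text \<open>The rectangle without its side \<open>t = 1\<close> is the full preimage of the piece,
  since this side goes to \<Gamma>. The side \<open>t = 0\<close> goes to \<open>v\<close> and plays
  the role of the centre in polar coordinates.\<close>

lemma piece_homeomorphic_disk: "subtopology M piece homeomorphic_space open_disk"
proof -
  let ?S = "{0..1::real} \<times> {0..<1::real}"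
  have bottom: "band (x, 0) = v" if "x \<in> {0..1}" for x
    using band_end[OF that, of 0] apex_constant by auto
  have top: "band (x, 1) \<in> \<Gamma>" if "x \<in> {0..1}" for x
    using band_end[OF that, of 1] far_end_in_\<Gamma> by (metis insertCI)
  have "v \<notin> open_band"
    using open_band_disjoint_V v_in_V by blast
  have S: "?S = strip \<union> {0..1} \<times> {0}"
    by (auto simp: strip_def)
  have "band ` ({0..1} \<times> {0}) = {v}"
    using bottom by (auto intro!: image_eqI[of _ _ "(0, 0)"])
  then have img: "band ` ?S = piece"
    unfolding S image_Un band_image_strip piece_eq_insert by simp
  have "quotient_map (top_of_set ?S) (subtopology M piece) band"
    unfolding img[symmetric]
  proof (rule quotient_map_restrict_compact[OF _ continuous_band Hausdorff])
    show "compact ({0..1::real} \<times> {0..1::real})"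
      by (intro compact_Times) auto
    show "p \<in> ?S" if "p \<in> {0..1} \<times> {0..1}" "band p \<in> band ` ?S" for p
    proof -
      have "snd p \<noteq> 1"
        using top[of "fst p"] that unfolding img piece_def by (cases p) auto
      then show ?thesis
        using that(1) by auto
    qed
  qed auto
  moreover have "band p = band p' \<longleftrightarrow> p = p' \<or> (snd p = 0 \<and> snd p' = 0) \<or> ({fst p, fst p'} = {0, 1} \<and> snd p = snd p')"
    if pp: "p \<in> ?S" "p' \<in> ?S" for p p'
  proof -
    have in_open_band: "band r \<in> open_band" if "r \<in> strip" for r
      using band_image_strip that by blast
    \<comment> \<open>A reflected closing would give \<open>q 0 1 = q n 0 = v = q 0 0\<close>, but
      the ends of an arc are distinct. So the cycle closes up directly.\<close>
    have "q n \<noteq> (\<lambda>t. q 0 (1 - t))"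
      using apex_constant[of n] apex_constant[of 0] edge_paramD(6)[OF param[of 0]]
      by (metis diff_zero)
    then have closed_up: "band (1, t) = band (0, t)" if "t \<in> {0..1}" for t
      using closing band_0[OF that] band_1[OF that] by simp
    consider "snd p = 0" "snd p' = 0" | "snd p = 0" "p' \<in> strip" | "p \<in> strip" "snd p' = 0"
      | "p \<in> strip" "p' \<in> strip"
      using pp unfolding S by auto
    then show ?thesis
    proof cases
      case 1
      then show ?thesis
        using bottom[of "fst p"] bottom[of "fst p'"] that by (cases p; cases p') auto
    next
      case 2
      then have "band p \<noteq> band p'" "snd p' \<noteq> 0"
        using bottom[of "fst p"] in_open_band[of p'] \<open>v \<notin> open_band\<close> that by (cases p; auto simp: strip_def)+
      then show ?thesis using 2(1) by auto
    next
      case 3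
      then have "band p \<noteq> band p'" "snd p \<noteq> 0"
        using bottom[of "fst p'"] in_open_band[of p] \<open>v \<notin> open_band\<close> that by (cases p'; auto simp: strip_def)+
      then show ?thesis using 3(2) by auto
    next
      case 4
      then have "snd p \<noteq> 0" by (auto simp: strip_def)
      then show ?thesis
        using band_eq_iff[OF 4, of "\<lambda>t. t"] closed_up by auto
    qed
  qed
  ultimately show ?thesis
    by (rule homeomorphic_open_disk)
qed

lemma component_with_vertex:
  assumes C: "C \<in> connected_components_of (subtopology M (topspace M - \<Gamma>))" and "v \<in> C"
  shows "subtopology M C homeomorphic_space open_disk" "V \<inter> C = {v}"
proof -
  have "C = piece"
    using piece_eq_component[OF C openin_piece] v_in_piece assms(2) by blast
  then show "subtopology M C homeomorphic_space open_disk" "V \<inter> C = {v}"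
    using piece_homeomorphic_disk piece_eq_insert open_band_disjoint_V v_in_V by auto
qed

end

end

section \<open>Components of the complement of the type II subgraph\<close>

context two_coloured_triangulation
begin

text \<open>The cycle of faces is combinatorial; what has to be added is a direction for each edge
  such that consecutive edges have their common vertex at the same parameter. Directions are
  propagated along the cycle by dependent choice, starting with the given \<open>p\<close>.\<close>

lemma face_cycle_exists:
  assumes start: "F \<in> FF" "a \<in> A" "a \<subseteq> F" and p: "edge_param a p"
  obtains n f e q \<phi> where "face_cycle M V E A FF n f e q \<phi>" "f 0 = F" "q 0 = p"
proof -
  have two_faces_A: "card {F \<in> FF. a \<subseteq> F} = 2" if "a \<in> A" for a
    by (rule two_faces) (use A_subset that in blast)
  obtain f e n where n: "n > (0::nat)" and f0: "f 0 = F" and e0: "e 0 = a" "e n = e 0"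
    and cyc: "\<And>i. f i \<in> FF" "\<And>i. e i \<in> A" "\<And>i. e i \<subseteq> f i" "\<And>i. e (Suc i) \<subseteq> f i" "\<And>i. e i \<noteq> e (Suc i)"
    and inj: "inj_on f {..<n}" "inj_on e {..<n}"
    and faces: "\<And>i F. \<lbrakk>F \<in> FF; e i \<subseteq> F\<rbrakk> \<Longrightarrow> F \<in> f ` {..<n}"
    by (rule alternating_cycle[of FF A "(\<subseteq>)" F a, OF fin(3) finite_subset[OF A_subset fin(2)] _ _ start])
      (rule two_edges, assumption, rule two_faces_A, assumption, (rule that; assumption))
  have "\<exists>g. \<forall>b. b \<in> A \<longrightarrow> edge_param b (g b) \<and> (b = a \<longrightarrow> g b = p)"
    using edge_param_exists A_subset p by (intro choice) blast
  then obtain g where g: "\<And>b. b \<in> A \<Longrightarrow> edge_param b (g b)" "g a = p"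
    using start(2) by blast
  \<comment> \<open>Each edge may use only one fixed parametrisation \<open>g\<close> or its
    reverse. On the return to \<open>e n = e 0\<close> this leaves just \<open>p\<close> and the
    reverse of \<open>p\<close>, which is the closing condition.\<close>
  define P where "P i q \<longleftrightarrow> (q = g (e i) \<or> q = (\<lambda>t. g (e i) (1 - t))) \<and> (i = 0 \<longrightarrow> q = p)" for i q
  have param: "edge_param (e i) q" if "P i q" for i q
    using that g(1)[OF cyc(2)] edge_param_reverse[OF g(1)[OF cyc(2)]] unfolding P_def by blast
  have "\<exists>q. \<forall>i. P i (q i) \<and> (q i 0 = q (Suc i) 0 \<or> q i 1 = q (Suc i) 1)"
  proof (rule dependent_nat_choice)
    show "\<exists>q. P 0 q"
      unfolding P_def using e0(1) g(2) by blast
    show "\<exists>q'. P (Suc i) q' \<and> (q 0 = q' 0 \<or> q 1 = q' 1)" if q: "P i q" for i q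
    proof -
      obtain q' where "q' = g (e (Suc i)) \<or> q' = (\<lambda>t. g (e (Suc i)) (1 - t))" "q 0 = q' 0 \<or> q 1 = q' 1"
        by (rule orient_next_edge[OF cyc(1,2) cyc(2)[of "Suc i"] cyc(3-5) param[OF q] g(1)[OF cyc(2)]])
      then show ?thesis
        unfolding P_def by (intro exI[of _ q']) simp
    qed
  qed
  then obtain q where q: "\<And>i. P i (q i)" "\<And>i. q i 0 = q (Suc i) 0 \<or> q i 1 = q (Suc i) 1"
    by blast
  have "\<forall>i. \<exists>\<phi>. chart (f i) (q i) (q (Suc i)) \<phi>"
    using chart_exists[OF cyc(1,2) cyc(2) cyc(3-5) param[OF q(1)] param[OF q(1)] q(2)] by blast
  then obtain \<phi> where \<phi>: "\<And>i. chart (f i) (q i) (q (Suc i)) (\<phi> i)"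
    using choice[of "\<lambda>i \<phi>. chart (f i) (q i) (q (Suc i)) \<phi>"] by blast
  have q0: "q 0 = p" "p = g (e n)"
    using q(1)[of 0] e0 g(2) unfolding P_def by simp_all
  have "face_cycle M V E A FF n f e q \<phi>"
  proof unfold_locales
    show "q n = q 0 \<or> q n = (\<lambda>t. q 0 (1 - t))"
      using q(1)[of n] unfolding P_def q0 by blast
  qed (use n e0 cyc inj faces param[OF q(1)] \<phi> in \<open>simp_all\<close>)
  then show thesis
    using that f0 q0(1) by blast
qed

theorem component_shape:
  assumes C: "C \<in> connected_components_of (subtopology M (topspace M - \<Gamma>))"
  shows "V \<inter> C = {} \<and> (subtopology M C homeomorphic_space open_cylinder \<or>
      subtopology M C homeomorphic_space open_moebius_strip) \<or>
    (\<exists>v. V \<inter> C = {v}) \<and> subtopology M C homeomorphic_space open_disk"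
proof (cases "V \<inter> C = {}")
  case False
  then obtain v where v: "v \<in> V" "v \<in> C" by blast
  have C_sub: "C \<subseteq> topspace M - \<Gamma>"
    using connected_components_of_subset[OF C] by auto
  then have v\<Gamma>: "v \<notin> \<Gamma>" using v(2) by blast
  obtain a where a: "a \<in> E" "v \<in> a"
    using vertex_in_edge v(1) by blast
  then have aA: "a \<in> A"
    using v\<Gamma> unfolding \<Gamma>_def by blast
  have "{F \<in> FF. a \<subseteq> F} \<noteq> {}"
    using two_faces[OF a(1)] by (metis card.empty zero_neq_numeral)
  then obtain F where F: "F \<in> FF" "a \<subseteq> F" by blast
  \<comment> \<open>The direction of the first edge is chosen to start at \<open>v\<close>, so that
    \<open>v\<close> becomes the apex at \<open>t = 0\<close> of all strips.\<close>
  obtain p where p: "edge_param a p" "p 0 = v"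
  proof -
    obtain p where p: "edge_param a p"
      using edge_param_exists[OF a(1)] by blast
    then have "v = p 0 \<or> v = p 1"
      using edge_paramD(9)[OF p a(2) v(1)] by simp
    then show thesis
      using that[OF p] that[OF edge_param_reverse[OF p]] by auto
  qed
  obtain n f e q \<phi> where cyc: "face_cycle M V E A FF n f e q \<phi>" "f 0 = F" "q 0 = p"
    by (rule face_cycle_exists[OF F(1) aA F(2) p(1)])
  interpret face_cycle M V E A FF n f e q \<phi> by (rule cyc(1))
  have "q 0 0 = v" using cyc(3) p(2) by simp
  then show ?thesis
    using component_with_vertex[OF v\<Gamma> _ C v(2)] by blast
next
  case True
  obtain x where x: "x \<in> C"
    using nonempty_connected_components_of[OF C] by blast
  then have x\<Gamma>: "x \<in> topspace M" "x \<notin> \<Gamma>"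
    using connected_components_of_subset[OF C] by auto
  then obtain F where F: "F \<in> FF" "x \<in> F"
    unfolding topspace_eq by blast
  have "{a \<in> A. a \<subseteq> F} \<noteq> {}"
    using two_edges[OF F(1)] by (metis card.empty zero_neq_numeral)
  then obtain a where a: "a \<in> A" "a \<subseteq> F" by blast
  then obtain p where p: "edge_param a p"
    using edge_param_exists A_subset by blast
  obtain n f e q \<phi> where cyc: "face_cycle M V E A FF n f e q \<phi>" "f 0 = F" "q 0 = p"
    by (rule face_cycle_exists[OF F(1) a p])
  interpret face_cycle M V E A FF n f e q \<phi> by (rule cyc(1))
  have "x \<in> piece"
    using F(2) cyc(2) n_pos x\<Gamma>(2) unfolding piece_def by blast
  then show ?thesis
    using component_without_vertex[OF C _ True] x True by blast
qed

end

lemma connected_components_of_nonempty: "topspace X \<noteq> {} \<Longrightarrow> connected_components_of X \<noteq> {}"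
  by (simp add: connected_components_of_eq_empty flip: null_topspace_iff_trivial)

text \<open>Serves to exclude the degenerate situation of a graph with one vertex and no edges that
  fills all of \<open>M\<close>.\<close>

lemma singleton_not_homeomorphic_open_disk: "\<not> subtopology M {v} homeomorphic_space open_disk"
proof
  assume "subtopology M {v} homeomorphic_space open_disk"
  then obtain f where "homeomorphic_map (subtopology M {v}) open_disk f"
    using homeomorphic_space by blast
  then have "f ` (topspace M \<inter> {v}) = ball 0 1"
    using homeomorphic_imp_surjective_map by (fastforce simp: open_disk_def)
  then have "ball 0 1 \<subseteq> {f v}" by blast
  then have "0 \<in> {f v}" "1/2 \<in> {f v}"
    by (rule subsetD; simp)+
  then show False by simp
qed

section \<open>From zigzags to a colouring of the edges with two colours\<close>

locale type_I_triangulation =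
  fixes M :: "'a topology" and V :: "'a set" and E :: "'a set set"
    and \<tau> :: "(nat \<Rightarrow> 'a set) set set"
  assumes surface: "closed_surface M"
    and triangulation: "surface_triangulation M V E"
    and orientation: "z_orientation M V E \<tau>"
    and type_I: "\<And>F. F \<in> faces M V E \<Longrightarrow> face_type_I V E \<tau> F"
begin

lemma graph: "embedded_graph M V E" "connected_graph V E"
  using triangulation by (auto simp: surface_triangulation_def two_cell_embedding_def)

lemma arcs: "e \<in> E \<Longrightarrow> edge_arc M V e" "\<lbrakk>e \<in> E; e' \<in> E; e \<noteq> e'\<rbrakk> \<Longrightarrow> e \<inter> e' \<subseteq> V"
  using graph(1) unfolding embedded_graph_def by blast+

lemma finite_graph: "finite V" "finite E" "V \<noteq> {}" "V \<subseteq> topspace M"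
  using graph(1) unfolding embedded_graph_def by auto

lemma edge_ends:
  assumes "e \<in> E"
  obtains x y where "e \<inter> V = {x, y}" "x \<noteq> y"
proof -
  obtain g where g: "embedding_map (top_of_set {0..1::real}) M g" "e \<inter> V = {g 0, g 1}"
    using arcs(1)[OF assms] unfolding edge_arc_def by blast
  have "inj_on g {0..1}"
    using g(1) by (simp add: embedding_map_def homeomorphic_eq_everything_map)
  then have "g 0 \<noteq> g 1"
    using inj_onD[of g "{0..1}" 0 1] by auto
  then show thesis
    using that g(2) by blast
qed

text \<open>Taking the closure of an open face adds just the three sides, so the open face is
  recovered by deleting all edges. This is why closed faces alone can represent the cells.\<close>

lemma face_triangle:
  assumes "F \<in> faces M V E"
  obtains h where "triangle_map M h" "h ` std_triangle = F" "h ` interior std_triangle = F - \<Union>E"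
    "{h ` bottom_side, h ` left_side, h ` slanted_side} \<subseteq> E" "M closure_of (F - \<Union>E) = F"
    "F - \<Union>E \<in> open_faces M V E"
proof -
  obtain C where C: "C \<in> open_faces M V E" "F = M closure_of C"
    using assms unfolding faces_def by blast
  have "\<forall>C\<in>open_faces M V E. triangular M V E C"
    using triangulation by (simp add: surface_triangulation_def)
  then have "triangular M V E C"
    using C(1) by (rule bspec)
  from this[unfolded triangular_def, folded C(2) bottom_side_eq left_side_eq slanted_side_eq]
  obtain h where h: "embedding_map (top_of_set std_triangle) M h" "h ` std_triangle = F"
    "h ` interior std_triangle = C" "h ` bottom_side \<in> E" "h ` slanted_side \<in> E" "h ` left_side \<in> E"
    by (elim exE conjE) (rule that; assumption)
  have "triangle_map M h"
    using h(1) unfolding triangle_map_def embedding_map_def homeomorphic_eq_everything_map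
    by (simp add: continuous_map_in_subtopology)
  have F_eq: "F = C \<union> (h ` bottom_side \<union> h ` left_side \<union> h ` slanted_side)"
    using arg_cong[OF std_triangle_eq_sides, of "image h"] h(2,3) by (simp add: image_Un)
  have boundary: "h ` bottom_side \<union> h ` left_side \<union> h ` slanted_side \<subseteq> \<Union>E"
    using Union_upper[OF h(4)] Union_upper[OF h(6)] Union_upper[OF h(5)] by (intro Un_least)
  have "C \<inter> \<Union>E = {}"
    using connected_components_of_subset[of C] C(1) unfolding open_faces_def by force
  then have "(C \<union> S) - \<Union>E = C" if "S \<subseteq> \<Union>E" for S
    using that by blast
  from this[OF boundary] have interior: "F - \<Union>E = C"
    by (simp only: F_eq[symmetric])
  show thesis
    by (rule that[OF \<open>triangle_map M h\<close> h(2)]) (use h(3-6) C(1) in \<open>simp_all add: interior flip: C(2)\<close>)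
qed

text \<open>Without faces there are no edges, since every edge lies in two faces. A connected graph
  without edges is a single vertex, and with no open face this vertex is all of \<open>M\<close>,
  which contradicts the local disks.\<close>

lemma open_faces_nonempty: "open_faces M V E \<noteq> {}"
proof
  assume empty: "open_faces M V E = {}"
  then have "E = {}"
    using triangulation unfolding surface_triangulation_def faces_def by force
  obtain v where v: "v \<in> V" using finite_graph(3) by blast
  have "u = v" if "u \<in> V" for u
  proof -
    have "(v, u) \<in> {(x, y). \<exists>e\<in>E. e \<inter> V = {x, y}}\<^sup>*"
      using graph(2) v that unfolding connected_graph_def by blast
    then show ?thesis
      using \<open>E = {}\<close> by (auto elim: converse_rtranclE)
  qed
  then have "V = {v}" using v by blast
  moreover have "topspace M - (V \<union> \<Union>E) = {}"
    using empty connected_components_of_nonempty[of "subtopology M (topspace M - (V \<union> \<Union>E))"]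
    unfolding open_faces_def by auto
  ultimately have "topspace M = {v}"
    using \<open>E = {}\<close> finite_graph(4) by auto
  then obtain U where "openin M U" "v \<in> U" "subtopology M U homeomorphic_space open_disk"
    using surface unfolding closed_surface_def by blast
  moreover from this have "U = {v}"
    using openin_subset[of M U] \<open>topspace M = {v}\<close> by blast
  ultimately show False
    using singleton_not_homeomorphic_open_disk by metis
qed

text \<open>A vertex on no edge would be the only vertex, by connectedness of the graph. But some
  face exists, hence some edge, and an edge has two distinct ends.\<close>

lemma vertices_in_edges: "V \<subseteq> \<Union>E"
proof
  fix v assume v: "v \<in> V"
  obtain C where "C \<in> open_faces M V E"
    using open_faces_nonempty by blast
  then have "M closure_of C \<in> faces M V E"
    unfolding faces_def by blast
  then obtain e where e: "e \<in> E"
    using face_triangle by (metis insert_subset)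
  show "v \<in> \<Union>E"
  proof (rule ccontr)
    assume not_in: "v \<notin> \<Union>E"
    have "u = v" if "u \<in> V" for u
    proof -
      have "(v, u) \<in> {(x, y). \<exists>e\<in>E. e \<inter> V = {x, y}}\<^sup>*"
        using graph(2) v that unfolding connected_graph_def by blast
      then show ?thesis
        using not_in by (cases rule: converse_rtranclE) auto
    qed
    then show False
      using edge_ends[OF e] by (metis Int_iff insertCI)
  qed
qed

lemma faces_at_edge: "e \<in> E \<Longrightarrow> card {F \<in> faces M V E. e \<subseteq> F} = 2"
  using triangulation unfolding surface_triangulation_def by blast

text \<open>Every face contains one of the finitely many edges, and each of these lies in only two
  faces.\<close>

lemma finite_faces: "finite (faces M V E)"
proof -
  have "faces M V E \<subseteq> (\<Union>e\<in>E. {F \<in> faces M V E. e \<subseteq> F})"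
  proof
    fix F assume F: "F \<in> faces M V E"
    then obtain h where "h ` std_triangle = F" "h ` bottom_side \<in> E"
      using face_triangle by (metis insert_subset)
    moreover have "h ` bottom_side \<subseteq> h ` std_triangle"
      by (rule image_mono) (auto simp: bottom_side_def)
    ultimately show "F \<in> (\<Union>e\<in>E. {F \<in> faces M V E. e \<subseteq> F})"
      using F by blast
  qed
  moreover have "finite {F \<in> faces M V E. e \<subseteq> F}" if "e \<in> E" for e
    using faces_at_edge[OF that] by (metis card.infinite zero_neq_numeral)
  then have "finite (\<Union>e\<in>E. {F \<in> faces M V E. e \<subseteq> F})"
    using finite_graph(2) by (intro finite_UN_I)
  ultimately show ?thesis
    by (rule finite_subset)
qed

lemma topspace_faces: "topspace M = \<Union>(faces M V E)"
proof
  show "\<Union>(faces M V E) \<subseteq> topspace M"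
    unfolding faces_def by (intro Union_least) (auto dest: subsetD[OF closure_of_subset_topspace])
  show "topspace M \<subseteq> \<Union>(faces M V E)"
  proof
    fix x assume x: "x \<in> topspace M"
    show "x \<in> \<Union>(faces M V E)"
    proof (cases "x \<in> \<Union>E")
      case True
      then obtain e where e: "e \<in> E" "x \<in> e" by blast
      then have "{F \<in> faces M V E. e \<subseteq> F} \<noteq> {}"
        using faces_at_edge by (metis card.empty zero_neq_numeral)
      then show ?thesis using e(2) by blast
    next
      case False
      then have "x \<in> topspace (subtopology M (topspace M - (V \<union> \<Union>E)))"
        using x vertices_in_edges by auto
      then obtain C where C: "C \<in> open_faces M V E" "x \<in> C"
        unfolding Union_connected_components_of[symmetric] open_faces_def by blast
      then have "C \<subseteq> topspace M"
        using connected_components_of_subset[of C] unfolding open_faces_def by force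
      then have "x \<in> M closure_of C"
        using C(2) closure_of_subset by blast
      then show ?thesis
        using C(1) unfolding faces_def by blast
    qed
  qed
qed

text \<open>A common point off the edges lies in both open faces, which are components and hence
  equal; then so are their closures.\<close>

lemma faces_disjoint:
  assumes F: "F \<in> faces M V E" and F': "F' \<in> faces M V E" and "F \<noteq> F'"
  shows "F \<inter> F' \<subseteq> \<Union>E"
proof (rule ccontr)
  assume "\<not> F \<inter> F' \<subseteq> \<Union>E"
  then have "(F - \<Union>E) \<inter> (F' - \<Union>E) \<noteq> {}" by blast
  moreover have "F - \<Union>E \<in> open_faces M V E" "F' - \<Union>E \<in> open_faces M V E"
    "M closure_of (F - \<Union>E) = F" "M closure_of (F' - \<Union>E) = F'"
    using face_triangle[OF F] face_triangle[OF F'] by metis+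
  ultimately show False
    using connected_components_of_disjoint[of "F - \<Union>E" _ "F' - \<Union>E"] \<open>F \<noteq> F'\<close>
    unfolding open_faces_def disjnt_def by metis
qed

sublocale two_coloured_triangulation M V E "{e \<in> E. edge_type_I V \<tau> e}" "faces M V E"
proof unfold_locales
  show "Hausdorff_space M"
    "x \<in> topspace M \<Longrightarrow> \<exists>U. openin M U \<and> x \<in> U \<and> subtopology M U homeomorphic_space open_disk" for x
    using surface unfolding closed_surface_def by blast+
  show "\<exists>h. triangle_map M h \<and> h ` std_triangle = F \<and> h ` interior std_triangle = F - \<Union>E \<and>
      {h ` bottom_side, h ` left_side, h ` slanted_side} \<subseteq> E" if "F \<in> faces M V E" for F
    by (rule face_triangle[OF that]) (intro exI conjI; assumption)
  show "M closure_of (F - \<Union>E) = F" if "F \<in> faces M V E" for F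
    by (rule face_triangle[OF that])
  show "card {e \<in> {e \<in> E. edge_type_I V \<tau> e}. e \<subseteq> F} = 2" if "F \<in> faces M V E" for F
  proof -
    have "{e \<in> {e \<in> E. edge_type_I V \<tau> e}. e \<subseteq> F} = {e \<in> E. e \<subseteq> F \<and> edge_type_I V \<tau> e}"
      by blast
    then show ?thesis
      using type_I[OF that] unfolding face_type_I_def by simp
  qed
qed (use finite_graph finite_faces topspace_faces arcs vertices_in_edges faces_disjoint faces_at_edge in auto)

lemma common_vertex_in:
  assumes "e \<in> E" "e' \<in> E" "e \<noteq> e'" "F \<in> faces M V E" "e \<subseteq> F" "e' \<subseteq> F"
  shows "common_vertex V e e' \<in> V \<inter> e \<inter> e'"
proof -
  obtain a where a: "a \<in> V" "e \<inter> e' = {a}"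
    using face_edges_meet[OF assms(4) assms(1,2,5,6,3)] by blast
  then have "common_vertex V e e' = a"
    unfolding common_vertex_def by (intro the_equality) auto
  then show ?thesis using a by blast
qed

text \<open>The traversal starts at a vertex of the preceding edge and ends at one of the following
  edge, and in a zigzag these two edges have no common vertex.\<close>

lemma direction_ends_distinct:
  assumes "s \<in> \<Union>\<tau>"
  shows "fst (direction V s) \<noteq> snd (direction V s)"
proof -
  obtain z where "zigzag_seq M V E z" "s \<in> cyclic z"
    using orientation assms unfolding z_orientation_def zigzags_def by blast
  then obtain k where z: "zigzag_seq M V E z" and s: "\<And>i. s i = z (i + k)"
    unfolding cyclic_def by auto
  have adjacent: "s i \<in> E \<and> s i \<noteq> s (Suc i) \<and> (\<exists>F\<in>faces M V E. s i \<subseteq> F \<and> s (Suc i) \<subseteq> F)" for i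
    using z unfolding zigzag_seq_def s by simp
  have "common_vertex V (s i) (s (Suc i)) \<in> V \<inter> s i \<inter> s (Suc i)" for i
    using adjacent[of i] adjacent[of "Suc i"] common_vertex_in by blast
  from this[of 0] this[of 1] have "common_vertex V (s 0) (s 1) \<in> V \<inter> s 0" "common_vertex V (s 1) (s 2) \<in> V \<inter> s 2"
    by (simp_all add: numeral_2_eq_2)
  moreover have "s 0 \<inter> s 2 \<inter> V = {}"
    using z unfolding zigzag_seq_def s by (simp add: add.commute)
  ultimately show ?thesis
    unfolding direction_def by auto
qed

text \<open>With both types, the two occurrences would have directions that are equal and also
  reverse to each other, so the edge would be traversed from a vertex to itself.\<close>

lemma not_both_types: "\<not> (edge_type_I V \<tau> e \<and> edge_type_II V \<tau> e)"
proof
  assume "edge_type_I V \<tau> e \<and> edge_type_II V \<tau> e"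
  then obtain s t s' t' where st: "occurrences \<tau> e = {s, t}" "direction V t = prod.swap (direction V s)"
    and st': "occurrences \<tau> e = {s', t'}" "direction V t' = direction V s'"
    unfolding edge_type_I_def edge_type_II_def by blast
  have "direction V s = direction V t"
    using st(1) st' by (metis doubleton_eq_iff)
  then have "fst (direction V s) = snd (direction V s)"
    using st(2) by (metis fst_swap)
  moreover have "s \<in> \<Union>\<tau>"
    using st(1) unfolding occurrences_def by blast
  ultimately show False
    using direction_ends_distinct by blast
qed

text \<open>That every edge has a type is obtained by counting in a face instead of following
  zigzags: a face has at most three edges, and its two edges of type I and one of type II are
  already three different ones.\<close>

lemma type_II_iff:
  assumes "e \<in> E"
  shows "edge_type_II V \<tau> e \<longleftrightarrow> \<not> edge_type_I V \<tau> e"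
proof
  assume not_I: "\<not> edge_type_I V \<tau> e"
  have "{F \<in> faces M V E. e \<subseteq> F} \<noteq> {}"
    using faces_at_edge[OF assms] by (metis card.empty zero_neq_numeral)
  then obtain F where F: "F \<in> faces M V E" "e \<subseteq> F" by blast
  let ?I = "{e \<in> E. e \<subseteq> F \<and> edge_type_I V \<tau> e}" and ?II = "{e \<in> E. e \<subseteq> F \<and> edge_type_II V \<tau> e}"
  obtain h where h: "triangle_map M h" "h ` std_triangle = F" "h ` interior std_triangle = F - \<Union>E"
    "{h ` bottom_side, h ` left_side, h ` slanted_side} \<subseteq> E"
    using triangle[OF F(1)] by blast
  have "card {e \<in> E. e \<subseteq> F} \<le> 3"
    unfolding face_sides(1)[OF F(1) h] by (simp add: card_insert_if)
  moreover have "card (?I \<union> ?II) = 3"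
  proof -
    have "card (?I \<union> ?II) = card ?I + card ?II"
      using not_both_types finite_graph(2) by (intro card_Un_disjoint) auto
    then show ?thesis
      using type_I[OF F(1)] unfolding face_type_I_def by simp
  qed
  moreover have "?I \<union> ?II \<subseteq> {e \<in> E. e \<subseteq> F}" "finite {e \<in> E. e \<subseteq> F}"
    using finite_graph(2) by auto
  ultimately have "?I \<union> ?II = {e \<in> E. e \<subseteq> F}"
    by (intro card_seteq) auto
  then show "edge_type_II V \<tau> e"
    using not_I assms F(2) by blast
qed (use not_both_types in blast)

text \<open>A vertex of type II is an end of an edge of type II, and edges contain their ends; so
  the vertices add nothing to the union of the edges.\<close>

lemma type_II_subgraph_eq: "type_II_subgraph V E \<tau> = \<Gamma>"
  unfolding type_II_subgraph_def \<Gamma>_def vertex_type_I_def using type_II_iff by blast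

theorem component_classification:
  assumes C: "C \<in> connected_components_of (subtopology M (topspace M - type_II_subgraph V E \<tau>))"
  shows "(subtopology M C homeomorphic_space open_disk \<or>
       subtopology M C homeomorphic_space open_moebius_strip \<or>
       subtopology M C homeomorphic_space open_cylinder) \<and>
      ((\<exists>v\<in>V. vertex_type_I V E \<tau> v \<and> v \<in> C) \<longleftrightarrow>
         subtopology M C homeomorphic_space open_disk) \<and>
      (subtopology M C homeomorphic_space open_disk \<longrightarrow>
         (\<exists>!v. v \<in> V \<and> vertex_type_I V E \<tau> v \<and> v \<in> C))"
proof -
  have "C \<inter> type_II_subgraph V E \<tau> = {}"
    using connected_components_of_subset[OF C] by auto
  \<comment> \<open>All vertices of type II belong to the deleted subgraph, so the vertices in
    \<open>C\<close> are precisely its vertices of type I.\<close>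
  then have type_I_vertices: "v \<in> V \<and> vertex_type_I V E \<tau> v \<and> v \<in> C \<longleftrightarrow> v \<in> V \<inter> C" for v
    unfolding type_II_subgraph_def by blast
  have not_disk: "\<not> subtopology M C homeomorphic_space open_disk"
    if "subtopology M C homeomorphic_space open_cylinder \<or> subtopology M C homeomorphic_space open_moebius_strip"
    using that open_cylinder_not_open_disk open_moebius_strip_not_open_disk
      homeomorphic_space_trans homeomorphic_space_sym by metis
  have shape: "V \<inter> C = {} \<and> (subtopology M C homeomorphic_space open_cylinder \<or>
      subtopology M C homeomorphic_space open_moebius_strip) \<or>
    (\<exists>v. V \<inter> C = {v}) \<and> subtopology M C homeomorphic_space open_disk"
    using component_shape C unfolding type_II_subgraph_eq by simp
  have some_vertex: "(\<exists>v\<in>V. vertex_type_I V E \<tau> v \<and> v \<in> C) \<longleftrightarrow> V \<inter> C \<noteq> {}"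
    using type_I_vertices by blast
  have one_vertex: "(\<exists>!v. v \<in> V \<and> vertex_type_I V E \<tau> v \<and> v \<in> C) \<longleftrightarrow> (\<exists>v. V \<inter> C = {v})"
    unfolding type_I_vertices Ex1_def by blast
  show ?thesis
    unfolding some_vertex one_vertex using shape
  proof (elim disjE conjE exE)
    fix v assume "V \<inter> C = {v}" "subtopology M C homeomorphic_space open_disk"
    then show "(subtopology M C homeomorphic_space open_disk \<or>
       subtopology M C homeomorphic_space open_moebius_strip \<or>
       subtopology M C homeomorphic_space open_cylinder) \<and>
      ((V \<inter> C \<noteq> {}) = (subtopology M C homeomorphic_space open_disk)) \<and>
      (subtopology M C homeomorphic_space open_disk \<longrightarrow> (\<exists>v. V \<inter> C = {v}))"
      by simp
  qed (use not_disk in simp_all)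
qed

end

theorem theorem2:
  fixes M :: "'a topology" and V :: "'a set" and E :: "'a set set"
    and \<tau> :: "(nat \<Rightarrow> 'a set) set set"
  assumes "closed_surface M" and "connected_space M"
    and "surface_triangulation M V E"
    and "z_orientation M V E \<tau>"
    and "\<And>F. F \<in> faces M V E \<Longrightarrow> face_type_I V E \<tau> F"
  shows "\<forall>C \<in> connected_components_of (subtopology M (topspace M - type_II_subgraph V E \<tau>)).
      (subtopology M C homeomorphic_space open_disk \<or>
       subtopology M C homeomorphic_space open_moebius_strip \<or>
       subtopology M C homeomorphic_space open_cylinder) \<and>
      ((\<exists>v\<in>V. vertex_type_I V E \<tau> v \<and> v \<in> C) \<longleftrightarrow>
         subtopology M C homeomorphic_space open_disk) \<and>
      (subtopology M C homeomorphic_space open_disk \<longrightarrow>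
         (\<exists>!v. v \<in> V \<and> vertex_type_I V E \<tau> v \<and> v \<in> C))"
proof -
  interpret type_I_triangulation M V E \<tau>
    by unfold_locales (use assms in auto)
  show ?thesis
    using component_classification by blast
qed

end
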